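(* There is an absolute constant $c>0$ such that for every integer $\Delta\ge 2$ and every $n$ sufficiently large in terms of $\Delta$, there exists an acyclic digraph $H$ on $n$ vertices with maximum degree at most $\Delta$ for which $$\overrightarrow{r_1}(H)\ \ge\ n^{\,c\,\Delta^{2/3}/\log^{5/3}\Delta}.$$
   Context: All digraphs are finite, simple and oriented: no self-loops, no parallel edges, no anti-parallel edges. A digraph is acyclic if it has no directed cycle. The maximum degree of a digraph $H$ is $\max_{v\in V(H)}(|N^+(v)|+|N^-(v)|)$, where $N^+(v),N^-(v)$ are the out- and in-neighborhoods. A copy of $H$ in $T$ is given by an injective map $V(H)\to V(T)$ sending every edge of $H$ to an edge of $T$ with the same orientation (not necessarily induced). For an acyclic digraph $H$, the oriented Ramsey number $\overrightarrow{r_1}(H)$ is the least $N$ such that every tournament on $N$ vertices contains a copy of $H$. All logarithms are to base $2$; $\log^{5/3}\Delta=(\log\Delta)^{5/3}$. *)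

theory Defs
  imports Complex_Main "Graph_Theory.Pair_Digraph"
begin

locale oriented_digraph = pair_digraph G for G :: "'a pair_pre_digraph" +
  assumes no_antiparallel: "(u, v) \<in> parcs G \<Longrightarrow> (v, u) \<notin> parcs G"

locale acyclic_digraph = oriented_digraph +
  assumes no_cycle: "\<not> cycle p"

locale tournament = oriented_digraph +
  assumes arc_between:
    "\<lbrakk>u \<in> pverts G; v \<in> pverts G; u \<noteq> v\<rbrakk> \<Longrightarrow> (u, v) \<in> parcs G \<or> (v, u) \<in> parcs G"

definition out_nbhd :: "'a pair_pre_digraph \<Rightarrow> 'a \<Rightarrow> 'a set" where
  "out_nbhd G v = {w. (v, w) \<in> parcs G}"

definition in_nbhd :: "'a pair_pre_digraph \<Rightarrow> 'a \<Rightarrow> 'a set" where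
  "in_nbhd G v = {u. (u, v) \<in> parcs G}"

text \<open>Only meaningful for finite digraphs with at least one vertex.\<close>
definition max_degree :: "'a pair_pre_digraph \<Rightarrow> nat" where
  "max_degree G = Max ((\<lambda>v. card (out_nbhd G v) + card (in_nbhd G v)) ` pverts G)"

definition contains_copy :: "'a pair_pre_digraph \<Rightarrow> 'b pair_pre_digraph \<Rightarrow> bool" where
  "contains_copy T H \<longleftrightarrow>
    (\<exists>f. inj_on f (pverts H) \<and> f ` pverts H \<subseteq> pverts T \<and>
         (\<forall>(u, v) \<in> parcs H. (f u, f v) \<in> parcs T))"

text \<open>
  It is enough to consider tournaments whose vertices are natural numbers, since every finite
  tournament is isomorphic to one of these. For acyclic \<open>H\<close> the minimum is attained by
  \<open>oriented_ramsey_number_exists\<close> below.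
\<close>
definition oriented_ramsey_number :: "'a pair_pre_digraph \<Rightarrow> nat" where
  "oriented_ramsey_number H =
    (LEAST N. \<forall>T :: nat pair_pre_digraph.
       tournament T \<and> card (pverts T) = N \<longrightarrow> contains_copy T H)"

lemma transitive_list_exists:
  assumes "finite A" "2 ^ k \<le> card A"
    and "\<And>u v. u \<in> A \<Longrightarrow> v \<in> A \<Longrightarrow> u \<noteq> v \<Longrightarrow> (u, v) \<in> R \<or> (v, u) \<in> R"
  shows "\<exists>xs. length xs = k \<and> set xs \<subseteq> A \<and> distinct xs \<and> sorted_wrt (\<lambda>u v. (u, v) \<in> R) xs"
  using assms
proof (induction k arbitrary: A)
  case 0
  show ?case by (rule exI[of _ "[]"]) simp
next
  case (Suc k)
  have "card A > 0"
    using Suc.prems(2) by (meson less_le_trans zero_less_numeral zero_less_power)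
  then obtain v where v: "v \<in> A" by fastforce
  define Out where "Out = {w \<in> A - {v}. (v, w) \<in> R}"
  define In where "In = {w \<in> A - {v}. (w, v) \<in> R}"
  have fin: "finite Out" "finite In" and sub: "Out \<subseteq> A - {v}" "In \<subseteq> A - {v}"
    using Suc.prems(1) by (auto simp: Out_def In_def)
  have "A - {v} = Out \<union> In"
    using Suc.prems(3) v by (auto simp: Out_def In_def)
  then have "card A - 1 \<le> card Out + card In"
    using card_Un_le[of Out In] card_Diff_singleton[OF v] by simp
  then consider "2 ^ k \<le> card Out" | "2 ^ k \<le> card In"
    using Suc.prems(2) by fastforce
  then show ?case
  proof cases
    case 1
    obtain xs where "length xs = k" "set xs \<subseteq> Out" "distinct xs" "sorted_wrt (\<lambda>u v. (u, v) \<in> R) xs"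
      using Suc.IH[OF fin(1) 1] Suc.prems(3) sub by blast
    then show ?thesis
      using v sub by (intro exI[of _ "v # xs"]) (auto simp: Out_def)
  next
    case 2
    obtain xs where "length xs = k" "set xs \<subseteq> In" "distinct xs" "sorted_wrt (\<lambda>u v. (u, v) \<in> R) xs"
      using Suc.IH[OF fin(2) 2] Suc.prems(3) sub by blast
    then show ?thesis
      using v sub by (intro exI[of _ "xs @ [v]"]) (auto simp: In_def sorted_wrt_append)
  qed
qed

lemma topological_list_exists:
  assumes "finite V" "wf R"
  shows "\<exists>ys. set ys = V \<and> distinct ys \<and> sorted_wrt (\<lambda>u v. (v, u) \<notin> R) ys"
  using assms(1)
proof (induction "card V" arbitrary: V)
  case 0
  then show ?case by (intro exI[of _ "[]"]) simp
next
  case (Suc n)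
  obtain v where v: "v \<in> V" "\<And>w. (w, v) \<in> R \<Longrightarrow> w \<notin> V"
    using Suc.hyps(2) wfE_min'[OF assms(2), of V] by (metis card.empty nat.distinct(1))
  obtain ys where "set ys = V - {v}" "distinct ys" "sorted_wrt (\<lambda>u v. (v, u) \<notin> R) ys"
    using Suc.hyps(1)[of "V - {v}"] Suc.hyps(2) Suc.prems v(1) by force
  then show ?case
    using v by (intro exI[of _ "v # ys"]) auto
qed

lemma (in acyclic_digraph) wf_parcs: "wf (parcs G)"
proof (rule finite_acyclic_wf[OF pair_finite_arcs], rule acyclicI, intro allI notI)
  fix u assume "(u, u) \<in> (parcs G)\<^sup>+"
  then obtain p where "awalk u p u" "p \<noteq> []"
    using reachable1_awalk by blast
  then have "closed_w p" by (auto simp: closed_w_def)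
  then show False
    using closed_w_imp_cycle no_cycle by blast
qed

lemma oriented_ramsey_number_exists:
  assumes "acyclic_digraph H"
  shows "\<exists>N. \<forall>T :: nat pair_pre_digraph.
           tournament T \<and> card (pverts T) = N \<longrightarrow> contains_copy T H"
proof (intro exI allI impI)
  interpret H: acyclic_digraph H by fact
  fix T :: "nat pair_pre_digraph"
  assume T: "tournament T \<and> card (pverts T) = 2 ^ card (pverts H)"
  then interpret T: tournament T by simp
  obtain ys where ys: "set ys = pverts H" "distinct ys" "sorted_wrt (\<lambda>u v. (v, u) \<notin> parcs H) ys"
    using topological_list_exists[OF H.pair_finite_verts H.wf_parcs] by blast
  obtain xs where xs: "length xs = card (pverts H)" "set xs \<subseteq> pverts T" "distinct xs"
      "sorted_wrt (\<lambda>u v. (u, v) \<in> parcs T) xs"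
    using transitive_list_exists[OF T.pair_finite_verts, of "card (pverts H)" "parcs T"]
      T T.arc_between by auto
  have len: "length xs = length ys"
    using ys xs distinct_card by metis
  define f where "f y = xs ! (THE i. i < length ys \<and> ys ! i = y)" for y
  have f: "f (ys ! i) = xs ! i" if "i < length ys" for i
  proof -
    have "(THE j. j < length ys \<and> ys ! j = ys ! i) = i"
      using that ys(2) by (intro the_equality) (auto simp: nth_eq_iff_index_eq)
    then show ?thesis by (simp add: f_def)
  qed
  have "inj_on f (pverts H)"
    using f len xs(3) by (auto simp: inj_on_def ys(1)[symmetric] in_set_conv_nth nth_eq_iff_index_eq)
  moreover have "f ` pverts H \<subseteq> pverts T"
    using f len xs(2) nth_mem by (fastforce simp: ys(1)[symmetric] in_set_conv_nth)
  moreover have "(f u, f v) \<in> parcs T" if uv: "(u, v) \<in> parcs H" for u v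
  proof -
    obtain i j where ij: "i < length ys" "j < length ys" "u = ys ! i" "v = ys ! j"
      using H.in_arcsD1[OF uv] H.in_arcsD2[OF uv] by (auto simp: ys(1)[symmetric] in_set_conv_nth)
    have "i \<noteq> j" using H.pair_no_loops[OF uv] ij by auto
    moreover have "\<not> j < i" using ys(3) ij uv by (auto simp: sorted_wrt_iff_nth_less)
    ultimately show ?thesis
      using xs(4) ij len f by (auto simp: sorted_wrt_iff_nth_less)
  qed
  ultimately show "contains_copy T H"
    unfolding contains_copy_def by blast
qed

end

theory Submission
  imports Defs
begin

text \<open>
  The host tournament is the \<open>k\<close>-th lexicographic power of a tournament \<open>R\<close> with \<open>s\<close> vertices and
  no transitive subtournament on \<open>t\<close> vertices, where \<open>log s\<close> is of order \<open>t\<close>. The digraph \<open>H\<close> is an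
  interval mesh: its vertices are linearly ordered, nearby vertices are joined, and so are any two
  intervals whose distance is at most \<open>K\<close> times their length.
  A copy of \<open>H\<close> in the power colours the vertices of \<open>H\<close> by their first coordinates in \<open>R\<close>. Two
  intervals of the same colour that are close to each other force the gap between them to have that
  colour, and \<open>t\<close> intervals of distinct colours that are close to each other would form a
  transitive subtournament of \<open>R\<close>. Hence every interval contains a monochromatic one shorter only by
  a factor \<open>m = O(t)\<close>. Recursing into the next coordinate shows that \<open>H\<close> has at most \<open>O(m ^ k)\<close>
  vertices, against \<open>s ^ k\<close> vertices of the power.

  The degree of \<open>H\<close> can be kept at \<open>O(t powr (3/2))\<close>: all pairs at distance less than about
  \<open>t powr (3/2)\<close> are joined, which already yields monochromatic intervals of length about \<open>sqrt t\<close>, so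
  that the mesh condition with \<open>K = O(t\<^sup>2)\<close> is needed only at lengths above \<open>sqrt t\<close>; an edge of
  that scale is shared by all the vertices of an interval, and costs \<open>K / sqrt t\<close> per vertex in total.
\<close>

section \<open>Colourings of interval meshes\<close>

text \<open>Enumerating \<open>N\<close> in increasing order turns a chain indexed by an arbitrary
  finite set of positions into the sequence form that \<open>no_chain\<close> forbids.\<close>

lemma no_chain_set:
  fixes g :: "nat \<Rightarrow> 'c"
  assumes no_chain: "\<And>f :: nat \<Rightarrow> 'c. \<exists>i j. i < j \<and> j < t \<and> (f i, f j) \<notin> R"
    and "finite N" and chain: "\<And>k k'. \<lbrakk>k \<in> N; k' \<in> N; k < k'\<rbrakk> \<Longrightarrow> (g k, g k') \<in> R"
  shows "card N < t"
proof (rule ccontr)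
  assume "\<not> card N < t"
  then have t: "t \<le> card N" by simp
  define e where "e i = sorted_list_of_set N ! i" for i
  have "e i \<in> N" if "i < t" for i
    using that t assms(2) nth_mem[of i "sorted_list_of_set N"] by (simp add: e_def)
  moreover have "e i < e j" if "i < j" "j < t" for i j
    using that t strict_sorted_list_of_set[of N]
    by (auto simp: e_def sorted_wrt_iff_nth_less)
  ultimately have "(g (e i), g (e j)) \<in> R" if "i < j" "j < t" for i j
    using chain that by simp
  with no_chain[of "\<lambda>i. g (e i)"] show False by blast
qed

text \<open>\<open>m\<close> is the factor lost in passing from an interval to a monochromatic run
  inside it, and \<open>b\<close> is the least length at which \<open>mesh\<close> is available. The
  value \<open>K = 4 * t * m\<close> puts any two of the runs found in one interval within the reach
  of \<open>mesh\<close>.\<close>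

locale interval_mesh =
  fixes E :: "(nat \<times> nat) set" and K m b t :: nat
  assumes near: "\<lbrakk>x < y; y < x + m * b\<rbrakk> \<Longrightarrow> (x, y) \<in> E"
    and mesh: "\<lbrakk>b \<le> x; a + x \<le> a'; a' \<le> a + x + K * x\<rbrakk>
      \<Longrightarrow> \<exists>i\<in>{a..<a + x}. \<exists>j\<in>{a'..<a' + x}. (i, j) \<in> E"
    and b_pos: "0 < b" and t_pos: "0 < t" and m_def: "m = 4 * t" and K_def: "K = 4 * t * m"
begin

text \<open>Equal colours are allowed on an arc, since an arc of the lexicographic power may keep
  the first coordinate. The window is a parameter because the arguments recurse into
  subintervals.\<close>

definition hom_on :: "('c \<times> 'c) set \<Rightarrow> (nat \<Rightarrow> 'c) \<Rightarrow> nat \<Rightarrow> nat \<Rightarrow> bool" where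
  "hom_on R \<phi> lo hi \<longleftrightarrow>
    (\<forall>(x, y)\<in>E. lo \<le> x \<longrightarrow> x < hi \<longrightarrow> lo \<le> y \<longrightarrow> y < hi \<longrightarrow> \<phi> x = \<phi> y \<or> (\<phi> x, \<phi> y) \<in> R)"

lemma hom_onD:
  "\<lbrakk>hom_on R \<phi> lo hi; (x, y) \<in> E; lo \<le> x; x < hi; lo \<le> y; y < hi\<rbrakk> \<Longrightarrow> \<phi> x = \<phi> y \<or> (\<phi> x, \<phi> y) \<in> R"
  by (auto simp: hom_on_def)

lemma hom_on_mono: "\<lbrakk>hom_on R \<phi> lo hi; lo \<le> lo'; hi' \<le> hi\<rbrakk> \<Longrightarrow> hom_on R \<phi> lo' hi'"
  by (fastforce simp: hom_on_def)

definition mono_run :: "(nat \<Rightarrow> 'c) \<Rightarrow> nat \<Rightarrow> nat \<Rightarrow> bool" where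
  "mono_run \<phi> a y \<longleftrightarrow> (\<forall>i\<in>{a..<a + y}. \<phi> i = \<phi> a)"

lemma mono_runD: "\<lbrakk>mono_run \<phi> a y; a \<le> i; i < a + y\<rbrakk> \<Longrightarrow> \<phi> i = \<phi> a"
  unfolding mono_run_def by (erule bspec) simp

lemma mono_run_prefix: "\<lbrakk>mono_run \<phi> a y; x \<le> y\<rbrakk> \<Longrightarrow> mono_run \<phi> a x"
  unfolding mono_run_def by (intro ballI, erule bspec) simp

lemma m_pos: "0 < m" and mb_gt_1: "1 < m * b" and m_le_K: "m \<le> K"
proof -
  show m: "0 < m" using t_pos by (simp add: m_def)
  have "4 * 1 \<le> m * b" using b_pos t_pos unfolding m_def by (intro mult_le_mono) auto
  then show "1 < m * b" by simp
  show "m \<le> K" using t_pos m by (simp add: K_def)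
qed

lemma edge_between:
  assumes hom: "hom_on R \<phi> lo hi" and "lo \<le> a" "a + x \<le> a'" "a' + x \<le> hi" "b \<le> x"
    and "a' \<le> a + x + K * x"
    and "\<And>i. \<lbrakk>a \<le> i; i < a + x\<rbrakk> \<Longrightarrow> \<phi> i = c" "\<And>i. \<lbrakk>a' \<le> i; i < a' + x\<rbrakk> \<Longrightarrow> \<phi> i = c'"
  shows "c = c' \<or> (c, c') \<in> R"
proof -
  obtain i j where "i \<in> {a..<a + x}" "j \<in> {a'..<a' + x}" "(i, j) \<in> E"
    using mesh[of x a a'] assms by blast
  then show ?thesis
    using hom_onD[OF hom, of i j] assms by auto
qed

text \<open>
  A longest run inside the gap either has colour \<open>c\<close>, leaving a smaller gap, or has another colour,
  which then both dominates \<open>c\<close> and is dominated by \<open>c\<close>.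
\<close>
lemma fill_gap:
  assumes asym: "\<And>c d. (c, d) \<in> R \<Longrightarrow> (d, c) \<notin> R" and hom: "hom_on R \<phi> lo hi"
    and runs: "\<And>a h. \<lbrakk>lo \<le> a; a + h \<le> hi; m * b \<le> h; h < hi - lo\<rbrakk>
      \<Longrightarrow> \<exists>u y. a \<le> u \<and> u + y \<le> a + h \<and> mono_run \<phi> u y \<and> h \<le> m * y"
    and "lo + x \<le> p" "p \<le> q" "q + z \<le> hi" "b \<le> x" "b \<le> z" "q - p \<le> K * x" "q - p \<le> K * z"
    and left: "\<And>i. \<lbrakk>p \<le> i + x; i < p\<rbrakk> \<Longrightarrow> \<phi> i = c" and right: "\<And>i. \<lbrakk>q \<le> i; i < q + z\<rbrakk> \<Longrightarrow> \<phi> i = c"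
    and "p \<le> i" "i < q"
  shows "\<phi> i = c"
  using assms(4-)
proof (induction "q - p" arbitrary: p q x z i rule: less_induct)
  case less
  note IH = less.hyps
  show ?case
  proof (cases "\<phi> p = c")
    case True
    \<comment> \<open>A first point of colour \<open>c\<close> is absorbed into the left run, which
      shortens the gap by one.\<close>
    show ?thesis
    proof (cases "i = p")
      case False
      show ?thesis
      proof (rule IH[of q "Suc p" "Suc x" z i])
        show "q - Suc p \<le> K * Suc x" using less.prems(6) by simp
        show "\<phi> i = c" if "Suc p \<le> i + Suc x" "i < Suc p" for i
          using that less.prems(8)[of i] True by (cases "i = p") auto
      qed (use False less.prems in auto)
    qed (use True in simp)
  next
    case False
    have x: "0 < x" and z: "0 < z" using less.prems b_pos by auto
    have p: "\<phi> (p - 1) = c" "0 < p" "lo \<le> p - 1" "q < hi" "\<phi> q = c" "p < hi"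
      using less.prems(8)[of "p - 1"] less.prems(9)[of q] less.prems x z by auto
    have False
    proof (cases "q - p < m * b")
      case True
      have "p < q" using less.prems by simp
      \<comment> \<open>In a short gap, \<open>near\<close> joins \<open>p\<close> to points of
        colour \<open>c\<close> on both sides.\<close>
      have "(p - 1, p) \<in> E" "(p, q) \<in> E"
        using near[of "p - 1" p] near[of p q] p True \<open>p < q\<close> mb_gt_1 by auto
      then have "(c, \<phi> p) \<in> R" "(\<phi> p, c) \<in> R"
        using hom_onD[OF hom, of "p - 1" p] hom_onD[OF hom, of p q] p False less.prems by auto
      then show False using asym by blast
    next
      case gap: False
      \<comment> \<open>The two bordering runs are nonempty, so the gap is strictly shorter than
        \<open>hi - lo\<close>, as \<open>runs\<close> requires.\<close>
      have "\<exists>u y. p \<le> u \<and> u + y \<le> p + (q - p) \<and> mono_run \<phi> u y \<and> q - p \<le> m * y"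
        using less.prems gap x z by (intro runs) auto
      then obtain u y where u: "p \<le> u" "u + y \<le> q" "mono_run \<phi> u y" "q - p \<le> m * y"
        using less.prems by auto
      have "m * b \<le> m * y" using gap u by linarith
      then have y: "b \<le> y" "0 < y" using m_pos b_pos by auto
      have Ky: "q - p \<le> K * y" using u(4) m_le_K mult_le_mono1 le_trans by blast
      show False
      proof (cases "\<phi> u = c")
        case True
        then have "p < u" using False u by (metis nat_less_le)
        \<comment> \<open>The new run replaces the right border; the smaller gap in front of it
          would give \<open>p\<close> the colour \<open>c\<close>.\<close>
        have "\<phi> p = c"
        proof (rule IH[of u p x y p])
          show "\<phi> i = c" if "u \<le> i" "i < u + y" for i
            using mono_runD[OF u(3)] that True by simp
        qed (use \<open>p < u\<close> u y less.prems Ky in auto)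
        then show False using False by simp
      next
        case ne: False
        have 1: "c = \<phi> u \<or> (c, \<phi> u) \<in> R"
        proof -
          \<comment> \<open>\<open>edge_between\<close> compares runs of equal length, so both are
            cut to the shorter length, for which the gap is still at most
            \<open>K * v\<close>.\<close>
          define v where "v = min x y"
          have v: "v \<le> x" "v \<le> y" "b \<le> v" "q - p \<le> K * v"
            using less.prems y Ky by (auto simp: v_def min_def)
          show ?thesis
          proof (rule edge_between[OF hom, of "p - v" v u])
            show "\<phi> i = c" if "p - v \<le> i" "i < p - v + v" for i
              by (rule less.prems(8)) (use that v less.prems(1) in linarith)+
            show "\<phi> i = \<phi> u" if "u \<le> i" "i < u + v" for i
              by (rule mono_runD[OF u(3)]) (use that v in linarith)+
          qed (use v less.prems(1-7) u(1,2) in linarith)+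
        qed
        have 2: "\<phi> u = c \<or> (\<phi> u, c) \<in> R"
        proof -
          define v where "v = min z y"
          have v: "v \<le> z" "v \<le> y" "b \<le> v" "q - p \<le> K * v"
            using less.prems y Ky by (auto simp: v_def min_def)
          show ?thesis
          proof (rule edge_between[OF hom, of u v q])
            show "\<phi> i = c" if "q \<le> i" "i < q + v" for i
              by (rule less.prems(9)) (use that v in linarith)+
            show "\<phi> i = \<phi> u" if "u \<le> i" "i < u + v" for i
              by (rule mono_runD[OF u(3)]) (use that v in linarith)+
          qed (use v less.prems(1-7) u(1,2) in linarith)+
        qed
        show False using 1 2 ne asym by blast
      qed
    qed
    then show ?thesis ..
  qed
qed

text \<open>Cut the interval into \<open>2 * t\<close> pieces of length \<open>p\<close> and take a
  run in every other piece. The \<open>t\<close> runs are too many for a chain, so two of them share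
  a colour. By \<open>fill_gap\<close> this colour covers a whole skipped piece, and
  \<open>m * p\<close> with \<open>m = 4 * t\<close> already reaches the length of the
  interval.\<close>

lemma long_run_of_long:
  assumes asym: "\<And>c d. (c, d) \<in> R \<Longrightarrow> (d, c) \<notin> R"
    and no_chain: "\<And>f :: nat \<Rightarrow> 'c. \<exists>i j. i < j \<and> j < t \<and> (f i, f j) \<notin> R"
    and hom: "hom_on R \<phi> lo hi"
    and runs: "\<And>a h. \<lbrakk>lo \<le> a; a + h \<le> hi; m * b \<le> h; h < hi - lo\<rbrakk>
      \<Longrightarrow> \<exists>u y. a \<le> u \<and> u + y \<le> a + h \<and> mono_run \<phi> u y \<and> h \<le> m * y"
    and large: "2 * t * (m * b) \<le> hi - lo"
  shows "\<exists>a y. lo \<le> a \<and> a + y \<le> hi \<and> mono_run \<phi> a y \<and> hi - lo \<le> m * y"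
proof (rule ccontr)
  assume "\<not> ?thesis"
  then have short: "m * y < hi - lo" if "lo \<le> a" "a + y \<le> hi" "mono_run \<phi> a y" for a y
    using that by (meson not_le)
  define g where "g = hi - lo"
  define p where "p = g div (2 * t)"
  \<comment> \<open>The quotient of \<open>p\<close> by \<open>m\<close> rounded up: the common
    length to which all runs found in the pieces can be cut.\<close>
  define x where "x = (p + m - 1) div m"
  have p: "m * b \<le> p" unfolding p_def g_def
    using large t_pos by (metis div_le_mono mult_pos_pos nonzero_mult_div_cancel_left not_gr0 zero_less_numeral)
  have pg: "2 * t * p \<le> g" unfolding p_def by (metis div_times_less_eq_dividend mult.commute)
  have gp: "g < 2 * t * (p + 1)"
    unfolding p_def using t_pos by (metis dividend_less_times_div distrib_left mult_1_right mult_pos_pos zero_less_numeral add.commute mult.commute)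
  have p_pos: "0 < p" using p mb_gt_1 by linarith
  have "2 * 1 * p \<le> 2 * t * p" using t_pos by (intro mult_le_mono) auto
  then have p_less: "p < g" using pg p_pos by linarith
  have mx: "p \<le> m * x"
  proof -
    have "p + m - 1 < m * (x + 1)"
      unfolding x_def using m_pos by (metis dividend_less_times_div distrib_left mult_1_right add.commute)
    then show ?thesis by simp
  qed
  have "m * b \<le> m * x" using p mx by linarith
  then have bx: "b \<le> x" using m_pos by simp
  have piece: "\<exists>a. lo + 2 * i * p \<le> a \<and> a + x \<le> lo + (2 * i + 1) * p \<and> mono_run \<phi> a x" if i: "i < t" for i
  proof -
    have "(2 * i + 1) * p \<le> 2 * t * p" using i by (intro mult_le_mono) auto
    then have "lo + 2 * i * p + p \<le> hi" using pg p_less by (simp add: g_def algebra_simps)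
    then obtain u y where u: "lo + 2 * i * p \<le> u" "u + y \<le> lo + 2 * i * p + p"
      "mono_run \<phi> u y" "p \<le> m * y"
      using runs[of "lo + 2 * i * p" p] p p_less by (auto simp: g_def)
    have "p + m - 1 < (y + 1) * m" using u(4) m_pos by (simp add: algebra_simps)
    then have "x < y + 1" unfolding x_def by (rule less_mult_imp_div_less)
    then have "x \<le> y" by simp
    then have "u + x \<le> lo + (2 * i + 1) * p" using u(2) by (simp add: algebra_simps)
    then show ?thesis using u(1) mono_run_prefix[OF u(3) \<open>x \<le> y\<close>] by blast
  qed
  then have "\<forall>i. \<exists>a. i < t \<longrightarrow>
    lo + 2 * i * p \<le> a \<and> a + x \<le> lo + (2 * i + 1) * p \<and> mono_run \<phi> a x"
    by blast
  then obtain a where "\<forall>i. i < t \<longrightarrow>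
    lo + 2 * i * p \<le> a i \<and> a i + x \<le> lo + (2 * i + 1) * p \<and> mono_run \<phi> (a i) x"
    by (rule choice[THEN exE])
  then have a: "lo + 2 * i * p \<le> a i" "a i + x \<le> lo + (2 * i + 1) * p" "mono_run \<phi> (a i) x"
    if "i < t" for i
    using that by blast+
  have "2 * t * (p + 1) \<le> 2 * t * (p + p)" using p_pos by (intro mult_le_mono2) simp
  then have g_2p: "g \<le> 2 * t * (p + p)" using gp by linarith
  have gx: "g \<le> K * x"
  proof -
    have "g \<le> 2 * t * (p + p)" by (rule g_2p)
    also have "\<dots> \<le> 4 * t * (m * x)" using mult_le_mono2[OF mx, of "4 * t"] by simp
    finally show ?thesis by (simp add: K_def algebra_simps)
  qed
  \<comment> \<open>This is absurd; it follows because without a long run the chosen runs would form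
    a chain indexed by all \<open>i < t\<close>.\<close>
  have "card {..<t} < t"
  proof (rule no_chain_set[OF no_chain, where g = "\<lambda>i. \<phi> (a i)"])
    fix i j assume "i \<in> {..<t}" "j \<in> {..<t}" and ij: "i < j"
    then have i: "i < t" and j: "j < t" by auto
    have "(2 * i + 1) * p + p \<le> 2 * j * p"
      using mult_le_mono1[of "2 * i + 2" "2 * j" p] ij by (simp add: algebra_simps)
    then have sep: "a i + x \<le> lo + (2 * i + 1) * p" "lo + (2 * i + 1) * p + p \<le> a j"
      using a(2)[OF i] a(1)[OF j] by linarith+
    have "(2 * j + 1) * p \<le> 2 * t * p" using j by (intro mult_le_mono) auto
    then have aj: "a j + x \<le> hi" using a(2)[OF j] pg p_less by (simp add: g_def)
    have ai: "lo \<le> a i" using a(1)[OF i] by simp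
    have "\<phi> (a i) = \<phi> (a j) \<or> (\<phi> (a i), \<phi> (a j)) \<in> R"
    proof (rule edge_between[OF hom ai _ aj bx])
      show "a i + x \<le> a j" using sep by simp
      show "a j \<le> a i + x + K * x" using gx aj ai by (simp add: g_def)
    qed (use mono_runD[OF a(3)[OF i]] mono_runD[OF a(3)[OF j]] in blast)+
    moreover have "\<phi> (a i) \<noteq> \<phi> (a j)"
    proof
      assume eq: "\<phi> (a i) = \<phi> (a j)"
      have fill: "\<phi> k = \<phi> (a i)" if k: "a i + x \<le> k" "k < a j" for k
      proof (rule fill_gap[OF asym hom runs, of x "a i + x" "a j" x "\<phi> (a i)"])
        show "\<phi> k = \<phi> (a i)" if "a i + x \<le> k + x" "k < a i + x" for k
          by (rule mono_runD[OF a(3)[OF i]]) (use that in auto)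
        show "\<phi> k = \<phi> (a i)" if "a j \<le> k" "k < a j + x" for k
          unfolding eq by (rule mono_runD[OF a(3)[OF j]]) (use that in auto)
      qed (use ai aj sep bx gx k in \<open>auto simp: g_def\<close>)
      \<comment> \<open>The skipped piece after piece \<open>i\<close> lies entirely in the filled
        gap.\<close>
      have "mono_run \<phi> (lo + (2 * i + 1) * p) p"
        unfolding mono_run_def
      proof
        fix k assume "k \<in> {lo + (2 * i + 1) * p..<lo + (2 * i + 1) * p + p}"
        then show "\<phi> k = \<phi> (lo + (2 * i + 1) * p)"
          using fill[of k] fill[of "lo + (2 * i + 1) * p"] sep p_pos by simp
      qed
      then have "m * p < g"
        unfolding g_def by (intro short) (use sep aj in auto)
      moreover have "g \<le> m * p"
        using g_2p by (simp add: m_def algebra_simps)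
      ultimately show False by simp
    qed
    ultimately show "(\<phi> (a i), \<phi> (a j)) \<in> R" by blast
  qed simp
  then show False by simp
qed

text \<open>All pairs at distance below \<open>m * b\<close> are joined, so the first points of the
  mixed blocks are pairwise comparable. If two of them had the same colour, a point of another
  colour in the earlier block would have a colour that both follows and precedes theirs in
  \<open>R\<close>.\<close>

lemma few_mixed_blocks:
  assumes asym: "\<And>c d. (c, d) \<in> R \<Longrightarrow> (d, c) \<notin> R"
    and no_chain: "\<And>f :: nat \<Rightarrow> 'c. \<exists>i j. i < j \<and> j < t \<and> (f i, f j) \<notin> R"
    and hom: "hom_on R \<phi> lo hi" and "lo + m * b \<le> hi"
  shows "card {k. k < m \<and> \<not> mono_run \<phi> (lo + k * b) b} < t"
proof (rule no_chain_set[OF no_chain, where g = "\<lambda>k. \<phi> (lo + k * b)"])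
  fix k k' assume k: "k \<in> {k. k < m \<and> \<not> mono_run \<phi> (lo + k * b) b}"
    and k': "k' \<in> {k. k < m \<and> \<not> mono_run \<phi> (lo + k * b) b}" and "k < k'"
  then have "Suc k * b \<le> k' * b" "Suc k' * b \<le> m * b" by (intro mult_le_mono1, simp)+
  then have bd: "k * b + b \<le> k' * b" "k' * b + b \<le> m * b" by simp_all
  obtain i where i: "lo + k * b \<le> i" "i < lo + k * b + b" "\<phi> i \<noteq> \<phi> (lo + k * b)"
    using k by (auto simp: mono_run_def)
  then have lt: "lo + k * b < i" by (metis nat_less_le)
  have e: "(lo + k * b, i) \<in> E" "(i, lo + k' * b) \<in> E" "(lo + k * b, lo + k' * b) \<in> E"
    by (rule near; use lt i bd b_pos in linarith)+
  have "\<phi> (lo + k * b) \<noteq> \<phi> (lo + k' * b)"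
  proof
    assume eq: "\<phi> (lo + k * b) = \<phi> (lo + k' * b)"
    have "(\<phi> (lo + k * b), \<phi> i) \<in> R"
      using hom_onD[OF hom e(1)] i bd assms(4) b_pos by fastforce
    moreover have "(\<phi> i, \<phi> (lo + k * b)) \<in> R"
      using hom_onD[OF hom e(2)] i bd assms(4) b_pos unfolding eq[symmetric] by fastforce
    ultimately show False using asym by blast
  qed
  then show "(\<phi> (lo + k * b), \<phi> (lo + k' * b)) \<in> R"
    using hom_onD[OF hom e(3)] bd assms(4) b_pos by fastforce
qed simp

text \<open>Here pieces may be too short for \<open>runs\<close>, so blocks of length
  \<open>b\<close> take their place. Each of the \<open>q\<close> windows of \<open>m\<close> blocks
  has fewer than \<open>t\<close> mixed ones, which leaves at least \<open>q * t\<close>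
  monochromatic blocks. If no run is long, a colour occurs on at most \<open>q\<close> of them, so
  at least \<open>t\<close> colours occur, and blocks of distinct colours form a chain.\<close>

lemma long_run_of_short:
  assumes asym: "\<And>c d. (c, d) \<in> R \<Longrightarrow> (d, c) \<notin> R"
    and no_chain: "\<And>f :: nat \<Rightarrow> 'c. \<exists>i j. i < j \<and> j < t \<and> (f i, f j) \<notin> R"
    and hom: "hom_on R \<phi> lo hi"
    and runs: "\<And>a h. \<lbrakk>lo \<le> a; a + h \<le> hi; m * b \<le> h; h < hi - lo\<rbrakk>
      \<Longrightarrow> \<exists>u y. a \<le> u \<and> u + y \<le> a + h \<and> mono_run \<phi> u y \<and> h \<le> m * y"
    and small: "m * b \<le> hi - lo" "hi - lo < 2 * t * (m * b)"
  shows "\<exists>a y. lo \<le> a \<and> a + y \<le> hi \<and> mono_run \<phi> a y \<and> hi - lo \<le> m * y"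
proof (rule ccontr)
  assume "\<not> ?thesis"
  then have short: "m * y < hi - lo" if "lo \<le> a" "a + y \<le> hi" "mono_run \<phi> a y" for a y
    using that by (meson not_le)
  define g where "g = hi - lo"
  define q where "q = g div (m * b)"
  define B where "B k = lo + k * b" for k
  define M where "M = {k. k < q * m \<and> mono_run \<phi> (B k) b}"
  have mb: "0 < m * b" using mb_gt_1 by linarith
  have q_pos: "0 < q" using small mb by (simp add: q_def g_def div_greater_zero_iff)
  have qg: "q * (m * b) \<le> g" unfolding q_def by (rule div_times_less_eq_dividend)
  have gq: "g < (q + 1) * (m * b)"
    unfolding q_def using mb by (metis dividend_less_times_div add.commute distrib_right mult_1 mult.commute)
  have B_hi: "B k + b \<le> hi" if "k < q * m" for k
  proof -
    have "(k + 1) * b \<le> q * m * b" using that by (intro mult_le_mono1) simp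
    then show ?thesis using qg small b_pos m_pos by (simp add: B_def g_def algebra_simps)
  qed
  have B_less: "B k + b \<le> B k'" if "k < k'" for k k'
    using mult_le_mono1[of "Suc k" k' b] that by (simp add: B_def)
  have gK: "g \<le> K * b" using small(2) by (simp add: g_def K_def algebra_simps)

  have "card ({..<q * m} - M) \<le> q * (t - 1)"
  proof -
    have "{..<q * m} - M \<subseteq> (\<Union>w<q. (\<lambda>k. w * m + k) ` {k. k < m \<and> \<not> mono_run \<phi> (B (w * m) + k * b) b})"
    proof
      fix k assume k: "k \<in> {..<q * m} - M"
      have "k div m < q" using k by (simp add: less_mult_imp_div_less)
      moreover have "k = k div m * m + k mod m" "k mod m < m" using m_pos by simp_all
      moreover have "B (k div m * m) + k mod m * b = B k"
        unfolding B_def by (metis add.assoc distrib_right div_mult_mod_eq)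
      ultimately show "k \<in> (\<Union>w<q. (\<lambda>k. w * m + k) ` {k. k < m \<and> \<not> mono_run \<phi> (B (w * m) + k * b) b})"
        using k unfolding M_def by (intro UN_I[of "k div m"] image_eqI[of _ _ "k mod m"]) auto
    qed
    then have "card ({..<q * m} - M)
      \<le> card (\<Union>w<q. (\<lambda>k. w * m + k) ` {k. k < m \<and> \<not> mono_run \<phi> (B (w * m) + k * b) b})"
      by (intro card_mono) auto
    also have "\<dots> \<le> (\<Sum>w<q. card ((\<lambda>k. w * m + k) ` {k. k < m \<and> \<not> mono_run \<phi> (B (w * m) + k * b) b}))"
      by (intro card_UN_le) simp
    also have "\<dots> \<le> (\<Sum>w<q. t - 1)"
    proof (rule sum_mono)
      fix w assume w: "w \<in> {..<q}"
      have "(w + 1) * (m * b) \<le> q * (m * b)" using w by (intro mult_le_mono1) simp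
      then have "lo + (w + 1) * (m * b) \<le> hi" using qg small(1) mb unfolding g_def by linarith
      then have "B (w * m) + m * b \<le> hi" by (simp add: B_def algebra_simps)
      then have "card {k. k < m \<and> \<not> mono_run \<phi> (B (w * m) + k * b) b} < t"
        by (intro few_mixed_blocks[OF asym no_chain hom_on_mono[OF hom]]) (auto simp: B_def)
      then have "card {k. k < m \<and> \<not> mono_run \<phi> (B (w * m) + k * b) b} \<le> t - 1" by simp
      then show "card ((\<lambda>k. w * m + k) ` {k. k < m \<and> \<not> mono_run \<phi> (B (w * m) + k * b) b}) \<le> t - 1"
        by (intro le_trans[OF card_image_le]) auto
    qed
    finally show ?thesis by simp
  qed
  moreover have "card ({..<q * m} - M) = q * m - card M"
    by (subst card_Diff_subset) (auto simp: M_def)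
  ultimately have "q * m - q * (t - 1) \<le> card M" by linarith
  \<comment> \<open>At least half of the blocks of each window survive, since
    \<open>m = 4 * t\<close>.\<close>
  moreover have "q * t \<le> q * m - q * (t - 1)"
    unfolding diff_mult_distrib2[symmetric] using t_pos by (intro mult_le_mono2) (simp add: m_def)
  ultimately have card_M: "q * t \<le> card M" by linarith
  have fin: "finite M" by (simp add: M_def)

  \<comment> \<open>The gap between the first and the last block of colour \<open>c\<close> is
    filled with \<open>c\<close>. The resulting run consists of whole blocks, and more than
    \<open>q\<close> of them would make it long.\<close>
  have fibre: "card {k \<in> M. \<phi> (B k) = c} \<le> q" for c
  proof (cases "{k \<in> M. \<phi> (B k) = c} = {}")
    case False
    let ?F = "{k \<in> M. \<phi> (B k) = c}"
    have finF: "finite ?F" using fin by simp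
    define k1 k2 where "k1 = Min ?F" and "k2 = Max ?F"
    have k1: "k1 \<in> ?F" and k2: "k2 \<in> ?F" unfolding k1_def k2_def
      using Min_in[OF finF False] Max_in[OF finF False] by auto
    have sub: "?F \<subseteq> {k1..k2}" using finF by (auto simp: k1_def k2_def)
    have k12: "k1 \<le> k2" using k1 sub by auto
    have run1: "\<phi> i = c" if "B k1 \<le> i" "i < B k1 + b" for i
      using k1 mono_runD[of \<phi> "B k1" b i] that by (auto simp: M_def)
    have run2: "\<phi> i = c" if "B k2 \<le> i" "i < B k2 + b" for i
      using k2 mono_runD[of \<phi> "B k2" b i] that by (auto simp: M_def)
    have hi2: "B k2 + b \<le> hi" using k2 by (intro B_hi) (auto simp: M_def)
    have run: "\<phi> i = c" if i: "B k1 \<le> i" "i < B k2 + b" for i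
    proof (cases "k1 = k2 \<or> i < B k1 + b \<or> B k2 \<le> i")
      case True
      then show ?thesis using run1 run2 i by auto
    next
      case False
      then have "B k1 + b \<le> B k2" using k12 by (intro B_less) simp
      show ?thesis
      proof (rule fill_gap[OF asym hom runs, of b "B k1 + b" "B k2" b c])
        show "B k2 - (B k1 + b) \<le> K * b" "B k2 - (B k1 + b) \<le> K * b"
          using gK hi2 by (simp_all add: g_def B_def)
        show "lo + b \<le> B k1 + b" by (simp add: B_def)
        show "\<phi> i = c" if "B k1 + b \<le> i + b" "i < B k1 + b" for i
          by (rule run1) (use that in linarith)+
      qed (use False hi2 \<open>B k1 + b \<le> B k2\<close> in \<open>auto intro: run2\<close>)
    qed
    have len: "B k1 + (k2 - k1 + 1) * b = B k2 + b"
      using le_Suc_ex[OF k12] by (auto simp: B_def algebra_simps)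
    have "mono_run \<phi> (B k1) ((k2 - k1 + 1) * b)"
      unfolding mono_run_def len
    proof
      fix i assume "i \<in> {B k1..<B k2 + b}"
      then show "\<phi> i = \<phi> (B k1)" using run[of i] run[of "B k1"] by simp
    qed
    moreover have "B k1 + (k2 - k1 + 1) * b \<le> hi"
      using hi2 len by simp
    ultimately have "m * ((k2 - k1 + 1) * b) < g"
      unfolding g_def by (intro short) (auto simp: B_def)
    then have "(k2 - k1 + 1) * (m * b) < (q + 1) * (m * b)" using gq by (simp add: algebra_simps)
    then have "k2 - k1 + 1 < q + 1" using mult_less_cancel2 by blast
    moreover have "card ?F \<le> Suc k2 - k1" using card_mono[OF _ sub] by simp
    ultimately show ?thesis using k12 by linarith
  next
    case True
    show ?thesis unfolding True by simp
  qed

  have "card M \<le> (\<Sum>c\<in>(\<lambda>k. \<phi> (B k)) ` M. card {k \<in> M. \<phi> (B k) = c})"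
  proof -
    have "M = (\<Union>c\<in>(\<lambda>k. \<phi> (B k)) ` M. {k \<in> M. \<phi> (B k) = c})" by auto
    then show ?thesis using card_UN_le[of "(\<lambda>k. \<phi> (B k)) ` M" "\<lambda>c. {k \<in> M. \<phi> (B k) = c}"] fin by simp
  qed
  also have "\<dots> \<le> (\<Sum>c\<in>(\<lambda>k. \<phi> (B k)) ` M. q)" by (intro sum_mono fibre)
  finally have "card M \<le> q * card ((\<lambda>k. \<phi> (B k)) ` M)" by (simp add: mult.commute)
  then have "q * t \<le> q * card ((\<lambda>k. \<phi> (B k)) ` M)" using card_M by (rule order.trans[rotated])
  then have many: "t \<le> card ((\<lambda>k. \<phi> (B k)) ` M)" using q_pos by simp
  \<comment> \<open>One block is selected for each colour that occurs.\<close>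
  obtain N where N: "N \<subseteq> M" "inj_on (\<lambda>k. \<phi> (B k)) N" "(\<lambda>k. \<phi> (B k)) ` N = (\<lambda>k. \<phi> (B k)) ` M"
    using subset_image_inj[of "(\<lambda>k. \<phi> (B k)) ` M" "\<lambda>k. \<phi> (B k)" M] by auto
  have "card N < t"
  proof (rule no_chain_set[OF no_chain, where g = "\<lambda>k. \<phi> (B k)"])
    show "finite N" using N fin finite_subset by blast
    fix k k' assume k: "k \<in> N" "k' \<in> N" "k < k'"
    then have kM: "k \<in> M" "k' \<in> M" using N by auto
    then have hi': "B k' + b \<le> hi" by (intro B_hi) (auto simp: M_def)
    from kM have runs': "mono_run \<phi> (B k) b" "mono_run \<phi> (B k') b" by (auto simp: M_def)
    have "\<phi> (B k) = \<phi> (B k') \<or> (\<phi> (B k), \<phi> (B k')) \<in> R"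
    proof (rule edge_between[OF hom _ B_less[OF k(3)] hi' order_refl])
      show "B k' \<le> B k + b + K * b" using gK hi' by (simp add: g_def B_def)
      show "lo \<le> B k" by (simp add: B_def)
    qed (rule mono_runD[OF runs'(1)] mono_runD[OF runs'(2)]; assumption)+
    moreover have "\<phi> (B k) \<noteq> \<phi> (B k')" using N(2) k by (auto dest: inj_onD)
    ultimately show "(\<phi> (B k), \<phi> (B k')) \<in> R" by blast
  qed
  then show False using many card_image[OF N(2)] N(3) by simp
qed

text \<open>Strong induction on the length supplies \<open>runs\<close> to both cases. The threshold
  \<open>2 * t * (m * b)\<close> is where a piece of the long case reaches the length
  \<open>m * b\<close> to which the induction applies.\<close>

lemma long_run:
  assumes asym: "\<And>c d. (c, d) \<in> R \<Longrightarrow> (d, c) \<notin> R"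
    and no_chain: "\<And>f :: nat \<Rightarrow> 'c. \<exists>i j. i < j \<and> j < t \<and> (f i, f j) \<notin> R"
    and hom: "hom_on R \<phi> lo hi" and "m * b \<le> hi - lo"
  shows "\<exists>a y. lo \<le> a \<and> a + y \<le> hi \<and> mono_run \<phi> a y \<and> hi - lo \<le> m * y"
  using hom assms(4)
proof (induction "hi - lo" arbitrary: lo hi rule: less_induct)
  case less
  have runs: "\<exists>u y. a \<le> u \<and> u + y \<le> a + h \<and> mono_run \<phi> u y \<and> h \<le> m * y"
    if "lo \<le> a" "a + h \<le> hi" "m * b \<le> h" "h < hi - lo" for a h
    using less.hyps[of "a + h" a] that hom_on_mono[OF less.prems(1) that(1,2)] by auto
  show ?case
  proof (cases "2 * t * (m * b) \<le> hi - lo")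
    case True
    then show ?thesis by (intro long_run_of_long[OF asym no_chain less.prems(1) runs])
  next
    case False
    then show ?thesis
      by (intro long_run_of_short[OF asym no_chain less.prems(1) runs less.prems(2)]) auto
  qed
qed

end

section \<open>A sparse interval mesh\<close>

definition block :: "nat \<Rightarrow> nat \<Rightarrow> nat" where
  "block \<beta> j = \<beta> * 2 ^ j"

text \<open>
  The representatives of the blocks at level \<open>j\<close> start in the middle of a block: for blocks longer than
  \<open>2 * L\<close>, the sets of representatives at different levels are then disjoint, which keeps the degree
  bounded although there is no bound on the number of levels.
\<close>
definition offset_of :: "nat \<Rightarrow> nat \<Rightarrow> nat \<Rightarrow> nat" where
  "offset_of \<beta> j e = (block \<beta> j div 2 + e) mod block \<beta> j"

text \<open>The second set joins each aligned block of level \<open>j\<close> to the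
  \<open>e\<close>-th block after it by a single arc, whose two ends have the same position
  \<open>offset_of \<beta> j e\<close> in their blocks.\<close>

definition mesh_arcs :: "nat \<Rightarrow> nat \<Rightarrow> nat \<Rightarrow> (nat \<times> nat) set" where
  "mesh_arcs \<beta> w L = {(x, y). x < y \<and> y < x + w} \<union>
    {(x, x + e * block \<beta> j) | x j e. 1 \<le> e \<and> e \<le> L \<and> x mod block \<beta> j = offset_of \<beta> j e}"

lemma block_pos: "0 < \<beta> \<Longrightarrow> 0 < block \<beta> j"
  by (simp add: block_def)

lemma mesh_arcs_less: "0 < \<beta> \<Longrightarrow> (x, y) \<in> mesh_arcs \<beta> w L \<Longrightarrow> x < y"
  using block_pos by (fastforce simp: mesh_arcs_def)

lemma aligned_block:
  fixes B :: nat
  assumes "0 < B" "2 * B \<le> x"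
  obtains u where "a \<le> u * B" "u * B < a + B" "u * B + B \<le> a + x"
proof
  define u where "u = (a + B - 1) div B"
  have le: "u * B \<le> a + B - 1" unfolding u_def by (rule div_times_less_eq_dividend)
  then show "u * B < a + B" using assms by linarith
  then show "u * B + B \<le> a + x" using assms by linarith
  have "a + B - 1 < (u + 1) * B"
    unfolding u_def using assms(1) by (metis dividend_less_times_div add.commute distrib_right mult_1 mult.commute)
  then show "a \<le> u * B" by simp
qed

text \<open>At the largest level whose blocks satisfy \<open>2 * B <= x\<close>, each interval
  contains an aligned block, while \<open>x < 4 * B\<close>. The two blocks are therefore fewer than
  \<open>4 * K + 5\<close> blocks apart, which is where the bound on \<open>L\<close> comes
  from.\<close>

lemma mesh_arc_between:
  assumes "0 < \<beta>" and x: "2 * \<beta> \<le> x" and sep: "a + x \<le> a'" "a' \<le> a + x + K * x"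
    and L: "4 * K + 4 \<le> L"
  shows "\<exists>i\<in>{a..<a + x}. \<exists>k\<in>{a'..<a' + x}. (i, k) \<in> mesh_arcs \<beta> w L"
proof -
  have ex: "2 * block \<beta> 0 \<le> x" using x by (simp add: block_def)
  have bd: "j \<le> x" if "2 * block \<beta> j \<le> x" for j
  proof -
    have "j \<le> 2 ^ j" using less_exp[of j] by simp
    also have "\<dots> \<le> 2 * block \<beta> j" using assms(1) by (simp add: block_def)
    finally show ?thesis using that by simp
  qed
  define j where "j = (GREATEST j. 2 * block \<beta> j \<le> x)"
  have j: "2 * block \<beta> j \<le> x"
    unfolding j_def by (rule GreatestI_nat[of "\<lambda>j. 2 * block \<beta> j \<le> x", OF ex bd])
  have "\<not> 2 * block \<beta> (Suc j) \<le> x"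
    using Greatest_le_nat[of "\<lambda>j. 2 * block \<beta> j \<le> x" "Suc j" x] bd unfolding j_def[symmetric] by fastforce
  then have j': "x < 4 * block \<beta> j" by (simp add: block_def)
  define B where "B = block \<beta> j"
  have B: "0 < B" "2 * B \<le> x" "x < 4 * B" using j j' block_pos[OF assms(1)] by (auto simp: B_def)
  obtain u where u: "a \<le> u * B" "u * B < a + B" "u * B + B \<le> a + x"
    using aligned_block[OF B(1,2)] by blast
  obtain v where v: "a' \<le> v * B" "v * B < a' + B" "v * B + B \<le> a' + x"
    using aligned_block[OF B(1,2)] by blast
  have "u * B < v * B" using u v sep B(1) by linarith
  then have uv: "u < v" using mult_less_cancel2 by blast
  define e where "e = v - u"
  have eB: "v * B = u * B + e * B" using uv by (simp add: e_def algebra_simps diff_mult_distrib)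
  have "K * x \<le> K * (4 * B)" using B(3) by (intro mult_le_mono2) simp
  then have "e * B < x + K * (4 * B) + B" using eB u v sep by linarith
  then have "e * B < (4 * K + 5) * B" using B(3) by (simp add: algebra_simps)
  then have "e < 4 * K + 5" using mult_less_cancel2 by blast
  then have e: "1 \<le> e" "e \<le> L" using uv L by (auto simp: e_def)
  define r where "r = offset_of \<beta> j e"
  have r: "r < B" using B(1) by (simp add: r_def offset_of_def B_def)
  have "(u * B + r, u * B + r + e * B) \<in> mesh_arcs \<beta> w L"
    unfolding mesh_arcs_def
  proof (intro UnI2 CollectI exI conjI)
    show "(u * B + r) mod block \<beta> j = offset_of \<beta> j e" using r by (simp add: r_def B_def)
  qed (use e in \<open>simp_all add: B_def\<close>)
  then show ?thesis
    using u v r eB by (intro bexI[of _ "u * B + r"] bexI[of _ "u * B + r + e * B"]) auto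
qed

text \<open>All solutions are congruent modulo \<open>B\<close>, so each is determined by its
  quotient by \<open>B\<close>.\<close>

lemma card_mod_eq_le:
  fixes r c :: nat
  assumes "0 < B"
  shows "card {e. 1 \<le> e \<and> e \<le> L \<and> r = (c + e) mod B} \<le> L div B + 1"
proof -
  let ?S = "{e. 1 \<le> e \<and> e \<le> L \<and> r = (c + e) mod B}"
  have "inj_on (\<lambda>e. e div B) ?S"
  proof (rule inj_onI)
    fix d e assume d: "d \<in> ?S" and e: "e \<in> ?S" and eq: "d div B = e div B"
    have cancel: "d mod B = e mod B" if "(c + d) mod B = (c + e) mod B" "d \<le> e" for d e
    proof -
      have "(c + e) mod B = (c + d) mod B" using that(1) by (rule sym)
      then have "B dvd (c + e) - (c + d)" using that(2) by (subst (asm) mod_eq_dvd_iff_nat) simp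
      then have "B dvd e - d" by simp
      then have "e mod B = d mod B" using that(2) by (subst mod_eq_dvd_iff_nat)
      then show ?thesis by (rule sym)
    qed
    have "(c + d) mod B = (c + e) mod B" using d e by simp
    then have "d mod B = e mod B" using cancel[of d e] cancel[of e d] by (metis nat_le_linear)
    then show "d = e" using eq by (metis div_mult_mod_eq)
  qed
  moreover have "(\<lambda>e. e div B) ` ?S \<subseteq> {..L div B}" by (auto intro: div_le_mono)
  ultimately have "card ?S \<le> card {..L div B}" by (intro card_inj_on_le) auto
  then show ?thesis by simp
qed

text \<open>These pairs label the far arcs that leave \<open>x\<close> and also those that enter
  \<open>x\<close>, because a shift by whole blocks preserves the position in the block.\<close>

definition far_arcs_at :: "nat \<Rightarrow> nat \<Rightarrow> nat \<Rightarrow> (nat \<times> nat) set" where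
  "far_arcs_at \<beta> L x = {(j, e). 1 \<le> e \<and> e \<le> L \<and> x mod block \<beta> j = offset_of \<beta> j e}"

text \<open>At these levels the offset is half a block plus \<open>e\<close>, without reduction.
  Half of a larger block is a multiple of a smaller one, so membership at the larger level puts
  \<open>x\<close> in the first half of its smaller block, whereas membership at the smaller level
  puts it beyond the middle.\<close>

lemma far_arcs_at_large_unique:
  assumes "0 < \<beta>" and je: "(j, e) \<in> far_arcs_at \<beta> L x" "(j', e') \<in> far_arcs_at \<beta> L x"
    and large: "2 * L < block \<beta> j" "2 * L < block \<beta> j'" "1 \<le> j" "j \<le> j'"
  shows "(j, e) = (j', e')"
proof -
  have off: "offset_of \<beta> i d = block \<beta> i div 2 + d" if "2 * L < block \<beta> i" "d \<le> L" for i d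
    using that by (simp add: offset_of_def)
  have x: "x mod block \<beta> j = block \<beta> j div 2 + e" "x mod block \<beta> j' = block \<beta> j' div 2 + e'"
    "1 \<le> e" "e \<le> L" "1 \<le> e'" "e' \<le> L"
    using je large off by (auto simp: far_arcs_at_def)
  have "j = j'"
  proof (rule ccontr)
    assume "j \<noteq> j'"
    then obtain i where i: "j' = j + Suc i" using large(4) less_iff_Suc_add[of j j'] by auto
    have half: "block \<beta> j' div 2 = block \<beta> j * 2 ^ i" by (simp add: i block_def power_add)
    have "block \<beta> j dvd block \<beta> j'" by (simp add: i block_def power_add)
    then have "x mod block \<beta> j = (block \<beta> j' div 2 + e') mod block \<beta> j"
      using x(2) by (metis mod_mod_cancel)
    also have "\<dots> = e'" using x large by (simp add: half)
    finally have "e' = block \<beta> j div 2 + e" using x(1) by simp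
    moreover have "L \<le> block \<beta> j div 2" using large(1) by simp
    ultimately show False using x by linarith
  qed
  then show ?thesis using x by simp
qed

text \<open>Let \<open>J\<close> be the first level with blocks longer than \<open>2 * L\<close>.
  The levels from \<open>J\<close> on contribute at most one pair altogether. Below
  \<open>J\<close>, level \<open>j\<close> contributes at most
  \<open>L div block \<beta> j + 1\<close>; the quotients form a geometric sum, and \<open>J\<close>
  is at most \<open>2 ^ (J - 1)\<close>, hence of order \<open>L / \<beta>\<close>.\<close>

lemma far_arcs_at_bound:
  assumes "0 < \<beta>" and "\<beta> \<le> L"
  shows "finite (far_arcs_at \<beta> L x)" "card (far_arcs_at \<beta> L x) * \<beta> \<le> 6 * L + 3 * \<beta>"
proof -
  define J where "J = (LEAST J. 2 * L < block \<beta> J)"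
  have "2 * L < 2 ^ (2 * L)" by (rule less_exp)
  also have "\<dots> \<le> block \<beta> (2 * L)" using assms(1) by (simp add: block_def)
  finally have J: "2 * L < block \<beta> J" unfolding J_def by (rule LeastI)
  have J_le: "block \<beta> j \<le> 2 * L" if "j < J" for j
    using not_less_Least that unfolding J_def by (meson not_le)
  have J_pos: "1 \<le> J"
  proof (rule ccontr)
    assume "\<not> 1 \<le> J"
    then have "block \<beta> J = \<beta>" by (simp add: block_def)
    then show False using J assms(2) by simp
  qed
  define S where "S j = (\<lambda>e. (j, e)) ` {e. 1 \<le> e \<and> e \<le> L \<and> x mod block \<beta> j = (block \<beta> j div 2 + e) mod block \<beta> j}" for j
  define Big where "Big = {(j, e) \<in> far_arcs_at \<beta> L x. J \<le> j}"
  have mono: "block \<beta> J \<le> block \<beta> j" if "J \<le> j" for j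
    using that by (simp add: block_def)
  have "p \<in> far_arcs_at \<beta> L x \<longleftrightarrow> p \<in> (\<Union>j<J. S j) \<union> Big" for p
    by (cases p) (auto simp: far_arcs_at_def offset_of_def S_def Big_def image_iff not_le)
  then have eq: "far_arcs_at \<beta> L x = (\<Union>j<J. S j) \<union> Big" by blast
  have uniq: "p = p'" if "p \<in> Big" "p' \<in> Big" for p p'
  proof -
    obtain j e j' e' where [simp]: "p = (j, e)" "p' = (j', e')" by (metis surj_pair)
    have in_far: "(j, e) \<in> far_arcs_at \<beta> L x" "(j', e') \<in> far_arcs_at \<beta> L x" "J \<le> j" "J \<le> j'"
      using that by (auto simp: Big_def)
    have "2 * L < block \<beta> j" "2 * L < block \<beta> j'" "1 \<le> j" "1 \<le> j'"
      using mono[OF in_far(3)] mono[OF in_far(4)] J J_pos in_far by linarith+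
    then show ?thesis
      using far_arcs_at_large_unique[OF assms(1) in_far(1,2)] far_arcs_at_large_unique[OF assms(1) in_far(2,1)]
      by (cases "j \<le> j'") auto
  qed
  have finBig: "finite Big" and cardBig: "card Big \<le> 1"
  proof -
    have "\<exists>p. Big \<subseteq> {p}"
    proof (cases "Big = {}")
      case False
      then obtain p where "p \<in> Big" by blast
      then show ?thesis using uniq by blast
    qed auto
    then obtain p where p: "Big \<subseteq> {p}" by blast
    show "finite Big" using p by (rule finite_subset) simp
    show "card Big \<le> 1" using card_mono[OF _ p] by simp
  qed
  have finS: "finite (S j)" for j by (simp add: S_def)
  have cardS: "card (S j) \<le> L div block \<beta> j + 1" for j
    unfolding S_def by (rule le_trans[OF card_image_le card_mod_eq_le[OF block_pos[OF assms(1)]]]) simp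
  show "finite (far_arcs_at \<beta> L x)" unfolding eq using finS finBig by blast
  have "card (far_arcs_at \<beta> L x) \<le> card (\<Union>j<J. S j) + card Big"
    unfolding eq by (rule card_Un_le)
  also have "card (\<Union>j<J. S j) \<le> (\<Sum>j<J. card (S j))" by (intro card_UN_le) simp
  also have "\<dots> \<le> (\<Sum>j<J. L div block \<beta> j + 1)" by (intro sum_mono cardS)
  also have "\<dots> = (\<Sum>j<J. L div block \<beta> j) + J" by (simp only: sum.distrib) simp
  finally have card: "card (far_arcs_at \<beta> L x) \<le> (\<Sum>j<J. L div block \<beta> j) + J + 1" using cardBig by linarith
  have "J * \<beta> \<le> 2 * L + \<beta>"
  proof -
    have "J \<le> 2 ^ (J - 1)" using less_exp[of "J - 1"] by linarith
    then have "J * \<beta> \<le> block \<beta> (J - 1)" by (simp add: block_def mult.commute)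
    also have "\<dots> \<le> 2 * L" using J_pos by (intro J_le) simp
    finally show ?thesis by simp
  qed
  moreover have "(\<Sum>j<J. L div block \<beta> j) * \<beta> \<le> 2 * L"
  proof -
    have "real ((\<Sum>j<J. L div block \<beta> j) * \<beta>) = (\<Sum>j<J. real (L div block \<beta> j) * real \<beta>)"
      by (simp add: sum_distrib_right)
    also have "\<dots> \<le> (\<Sum>j<J. real L * (1 / 2) ^ j)"
    proof (rule sum_mono)
      fix j
      have "real (L div block \<beta> j * block \<beta> j) \<le> real L"
        by (rule of_nat_mono) (rule div_times_less_eq_dividend)
      then have "real (L div block \<beta> j) * real \<beta> * 2 ^ j \<le> real L"
        by (simp add: block_def mult.assoc)
      then show "real (L div block \<beta> j) * real \<beta> \<le> real L * (1 / 2) ^ j"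
        by (simp add: power_one_over field_simps)
    qed
    also have "\<dots> = real L * (\<Sum>j<J. (1 / 2) ^ j)" by (simp add: sum_distrib_left)
    also have "\<dots> \<le> real L * 2"
      by (intro mult_left_mono) (simp_all add: geometric_sum del: power_one_over)
    finally show ?thesis by linarith
  qed
  ultimately have "((\<Sum>j<J. L div block \<beta> j) + J + 1) * \<beta> \<le> 4 * L + 2 * \<beta>"
    by (simp add: algebra_simps)
  then show "card (far_arcs_at \<beta> L x) * \<beta> \<le> 6 * L + 3 * \<beta>"
    using mult_le_mono1[OF card, of \<beta>] by linarith
qed

lemma mesh_arcs_out_degree:
  assumes "0 < \<beta>" "\<beta> \<le> L"
  shows "finite {y. (x, y) \<in> mesh_arcs \<beta> w L}"
    and "card {y. (x, y) \<in> mesh_arcs \<beta> w L} \<le> w + card (far_arcs_at \<beta> L x)"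
proof -
  have sub: "{y. (x, y) \<in> mesh_arcs \<beta> w L} \<subseteq>
      {x..<x + w} \<union> (\<lambda>(j, e). x + e * block \<beta> j) ` far_arcs_at \<beta> L x"
    by (fastforce simp: mesh_arcs_def far_arcs_at_def)
  have fin: "finite ({x..<x + w} \<union> (\<lambda>(j, e). x + e * block \<beta> j) ` far_arcs_at \<beta> L x)"
    using far_arcs_at_bound(1)[OF assms] by blast
  show "finite {y. (x, y) \<in> mesh_arcs \<beta> w L}" using sub fin by (rule finite_subset)
  have "card {y. (x, y) \<in> mesh_arcs \<beta> w L}
      \<le> card {x..<x + w} + card ((\<lambda>(j, e). x + e * block \<beta> j) ` far_arcs_at \<beta> L x)"
    by (rule le_trans[OF card_mono[OF fin sub] card_Un_le])
  then show "card {y. (x, y) \<in> mesh_arcs \<beta> w L} \<le> w + card (far_arcs_at \<beta> L x)"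
    using card_image_le[OF far_arcs_at_bound(1)[OF assms], of "\<lambda>(j, e). x + e * block \<beta> j" x] by simp
qed

text \<open>The head of a far arc has the same residue as its tail, so the far arcs entering
  \<open>y\<close> are again labelled by \<open>far_arcs_at\<close> of \<open>y\<close>.\<close>

lemma mesh_arcs_in_degree:
  assumes "0 < \<beta>" "\<beta> \<le> L"
  shows "finite {x. (x, y) \<in> mesh_arcs \<beta> w L}"
    and "card {x. (x, y) \<in> mesh_arcs \<beta> w L} \<le> w + card (far_arcs_at \<beta> L y)"
proof -
  have sub: "{x. (x, y) \<in> mesh_arcs \<beta> w L} \<subseteq>
      {y - w..<y} \<union> (\<lambda>(j, e). y - e * block \<beta> j) ` far_arcs_at \<beta> L y"
  proof
    fix x assume "x \<in> {x. (x, y) \<in> mesh_arcs \<beta> w L}"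
    then consider "x < y" "y < x + w"
      | j e where "y = x + e * block \<beta> j" "1 \<le> e" "e \<le> L" "x mod block \<beta> j = offset_of \<beta> j e"
      by (auto simp: mesh_arcs_def)
    then show "x \<in> {y - w..<y} \<union> (\<lambda>(j, e). y - e * block \<beta> j) ` far_arcs_at \<beta> L y"
    proof cases
      case 2
      then show ?thesis
        by (intro UnI2 image_eqI[of _ _ "(j, e)"]) (simp_all add: far_arcs_at_def)
    qed auto
  qed
  have fin: "finite ({y - w..<y} \<union> (\<lambda>(j, e). y - e * block \<beta> j) ` far_arcs_at \<beta> L y)"
    using far_arcs_at_bound(1)[OF assms] by blast
  show "finite {x. (x, y) \<in> mesh_arcs \<beta> w L}" using sub fin by (rule finite_subset)
  have "card {x. (x, y) \<in> mesh_arcs \<beta> w L}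
      \<le> card {y - w..<y} + card ((\<lambda>(j, e). y - e * block \<beta> j) ` far_arcs_at \<beta> L y)"
    by (rule le_trans[OF card_mono[OF fin sub] card_Un_le])
  then show "card {x. (x, y) \<in> mesh_arcs \<beta> w L} \<le> w + card (far_arcs_at \<beta> L y)"
    using card_image_le[OF far_arcs_at_bound(1)[OF assms], of "\<lambda>(j, e). y - e * block \<beta> j" y] by simp
qed

section \<open>Tournaments without long transitive chains\<close>

text \<open>The counting argument of Erdos and Moser. A tournament is encoded by the set
  \<open>A\<close> of pairs oriented upwards; a prescribed chain of \<open>t\<close> vertices fixes
  the orientation of \<open>card I\<close> pairs, and there are only \<open>s ^ t\<close> candidates
  for the chain.\<close>

lemma tournament_without_chain_exists:
  assumes "s ^ t < 2 ^ (t * (t - 1) div 2)" and t: "1 < t"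
  shows "\<exists>R :: (nat \<times> nat) set.
    (\<forall>x y. (x, y) \<in> R \<longrightarrow> (y, x) \<notin> R) \<and>
    (\<forall>x<s. \<forall>y<s. x \<noteq> y \<longrightarrow> (x, y) \<in> R \<or> (y, x) \<in> R) \<and>
    (\<forall>f. \<exists>i j. i < j \<and> j < t \<and> (f i, f j) \<notin> R)"
proof -
  define P :: "(nat \<times> nat) set" where "P = {(x, y). x < y \<and> y < s}"
  define Arcs where "Arcs A = A \<union> {(y, x). (x, y) \<in> P - A}" for A :: "(nat \<times> nat) set"
  define I :: "(nat \<times> nat) set" where "I = {(i, j). i < j \<and> j < t}"
  define F where "F = {..<t} \<rightarrow>\<^sub>E {..<s}"
  \<comment> \<open>Membership in \<open>A\<close> of all pairs from the range of \<open>f\<close> is determined when \<open>f\<close> is a chain for \<open>A\<close>.\<close>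
  define Bad where "Bad f = {A. A \<subseteq> P \<and> (\<forall>(i, j)\<in>I. (f i, f j) \<in> Arcs A)}" for f
  have "P \<subseteq> {..<s} \<times> {..<s}" by (auto simp: P_def)
  then have finP: "finite P" by (rule finite_subset) simp
  have finI: "finite I"
    by (rule finite_subset[of _ "{..<t} \<times> {..<t}"]) (auto simp: I_def)
  have card_I: "card I = t * (t - 1) div 2"
  proof -
    have "I = (\<lambda>(j, i). (i, j)) ` (SIGMA j:{..<t}. {..<j})" by (auto simp: I_def)
    then have "card I = card (SIGMA j:{..<t}. {..<j})"
      by (simp only:) (rule card_image, auto simp: inj_on_def)
    also have "\<dots> = (\<Sum>j<t. j)" by simp
    also have "\<dots> = t * (t - 1) div 2"
      by (simp add: lessThan_atLeast0 Sum_Ico_nat)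
    finally show ?thesis .
  qed
  have card_Bad: "card (Bad f) * 2 ^ card I \<le> 2 ^ card P" if f: "f \<in> F" for f
  proof (cases "Bad f = {}")
    case False
    \<comment> \<open>\<open>pr\<close> sends a pair of indices to the vertex pair of
      \<open>P\<close> whose orientation it determines.\<close>
    define pr where "pr = (\<lambda>(i, j). (min (f i) (f j), max (f i) (f j)))"
    obtain A0 where "A0 \<in> Bad f" using False by blast
    then have ne: "f i \<noteq> f j" if "(i, j) \<in> I" for i j
      using that by (fastforce simp: Bad_def Arcs_def P_def)
    have inj: "inj_on f {..<t}"
    proof (rule inj_onI)
      fix i j assume "i \<in> {..<t}" "j \<in> {..<t}" "f i = f j"
      then show "i = j" using ne[of i j] ne[of j i] by (cases i j rule: linorder_cases) (auto simp: I_def)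
    qed
    have "inj_on pr I"
    proof (rule inj_onI)
      fix p p' assume pI: "p \<in> I" "p' \<in> I" and eq: "pr p = pr p'"
      obtain i j i' j' where [simp]: "p = (i, j)" "p' = (i', j')" by (metis surj_pair)
      have lt: "i < j" "j < t" "i' < j'" "j' < t" using pI by (auto simp: I_def)
      have "{f i, f j} = {f i', f j'}"
        using eq unfolding pr_def by (auto simp: min_def max_def split: if_splits)
      then have "f ` {i, j} = f ` {i', j'}" by simp
      then have "{i, j} = {i', j'}"
        using inj_on_image_eq_iff[OF inj, of "{i, j}" "{i', j'}"] lt by simp
      then show "p = p'" using lt by (auto simp: doubleton_eq_iff)
    qed
    then have card_pr: "card (pr ` I) = card I" by (rule card_image)
    have prP: "pr ` I \<subseteq> P"
    proof
      fix z assume "z \<in> pr ` I"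
      then obtain i j where ij: "(i, j) \<in> I" "z = pr (i, j)" by auto
      then have "f i < s" "f j < s" using f by (auto simp: F_def I_def PiE_def Pi_def)
      then show "z \<in> P" using ne[OF ij(1)] ij(2) by (auto simp: P_def pr_def min_def max_def)
    qed
    \<comment> \<open>The trace of \<open>A\<close> on these pairs depends on \<open>f\<close>
      alone, so \<open>A\<close> is recovered from its remaining pairs.\<close>
    have "A \<inter> pr ` I = pr ` {(i, j) \<in> I. f i < f j}" if "A \<in> Bad f" for A
    proof -
      have "pr (i, j) \<in> A \<longleftrightarrow> f i < f j" if ij: "(i, j) \<in> I" for i j
      proof -
        have "(f i, f j) \<in> Arcs A" "A \<subseteq> P" using \<open>A \<in> Bad f\<close> ij by (auto simp: Bad_def)
        then show ?thesis by (auto simp: Arcs_def P_def pr_def min_def max_def)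
      qed
      then show ?thesis by auto
    qed
    then have "inj_on (\<lambda>A. A - pr ` I) (Bad f)"
      by (intro inj_onI) (metis (no_types) Un_Diff_Int)
    moreover have "(\<lambda>A. A - pr ` I) ` Bad f \<subseteq> Pow (P - pr ` I)" by (auto simp: Bad_def)
    ultimately have "card (Bad f) \<le> card (Pow (P - pr ` I))"
      using finP by (metis card_inj_on_le finite_Diff finite_Pow_iff)
    also have "\<dots> = 2 ^ (card P - card I)"
      using prP card_pr finP finI by (simp add: card_Pow card_Diff_subset)
    finally have "card (Bad f) * 2 ^ card I \<le> 2 ^ (card P - card I) * 2 ^ card I" by simp
    also have "\<dots> = 2 ^ card P"
      using card_mono[OF finP prP] card_pr by (simp add: power_add[symmetric])
    finally show ?thesis .
  qed simp
  have finF: "finite F" and card_F: "card F = s ^ t"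
    unfolding F_def by (simp_all add: finite_PiE card_PiE)
  have "card (\<Union>f\<in>F. Bad f) * 2 ^ card I \<le> (\<Sum>f\<in>F. card (Bad f)) * 2 ^ card I"
    by (intro mult_le_mono1 card_UN_le finF)
  also have "\<dots> \<le> s ^ t * 2 ^ card P"
    unfolding sum_distrib_right using sum_bounded_above[of F "\<lambda>f. card (Bad f) * 2 ^ card I" "2 ^ card P"]
      card_Bad card_F by simp
  also have "\<dots> < 2 ^ card I * 2 ^ card P" using assms by (simp add: card_I)
  finally have "card (\<Union>f\<in>F. Bad f) < card (Pow P)" by (simp add: card_Pow finP)
  then have "\<not> Pow P \<subseteq> (\<Union>f\<in>F. Bad f)"
  proof -
    have "finite (Bad f)" for f using finP by (simp add: Bad_def)
    then have "finite (\<Union>f\<in>F. Bad f)" using finF by blast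
    then show ?thesis
      using card_mono[of "\<Union>f\<in>F. Bad f" "Pow P"] \<open>card (\<Union>f\<in>F. Bad f) < card (Pow P)\<close> by linarith
  qed
  then obtain A where A: "A \<subseteq> P" "A \<notin> (\<Union>f\<in>F. Bad f)" by (auto simp only: Pow_iff subset_iff)
  have "\<exists>i j. i < j \<and> j < t \<and> (f i, f j) \<notin> Arcs A" for f
  proof (rule ccontr)
    assume "\<not> ?thesis"
    then have chain: "(f i, f j) \<in> Arcs A" if "i < j" "j < t" for i j using that by blast
    \<comment> \<open>Since \<open>1 < t\<close>, every index below \<open>t\<close> belongs to some
      pair of the chain, so its value is an end of an arc.\<close>
    have bound: "f i < s" if "i < t" for i
    proof (cases "i = 0")
      case True
      then show ?thesis using chain[of 0 1] t A(1) by (auto simp: Arcs_def P_def)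
    next
      case False
      then show ?thesis using chain[of 0 i] that A(1) by (auto simp: Arcs_def P_def)
    qed
    have "restrict f {..<t} \<in> F" using bound by (auto simp: F_def)
    moreover have "A \<in> Bad (restrict f {..<t})"
      using A(1) chain by (auto simp: Bad_def I_def)
    ultimately show False using A(2) by blast
  qed
  moreover have "(y, x) \<notin> Arcs A" if "(x, y) \<in> Arcs A" for x y
    using that subsetD[OF A(1), of "(x, y)"] subsetD[OF A(1), of "(y, x)"]
    by (auto simp: Arcs_def P_def)
  moreover have "(x, y) \<in> Arcs A \<or> (y, x) \<in> Arcs A" if "x < s" "y < s" "x \<noteq> y" for x y
    using that by (auto simp: Arcs_def P_def)
  ultimately show ?thesis by (intro exI[of _ "Arcs A"] conjI allI impI) simp_all
qed

section \<open>Lexicographic powers of a tournament\<close>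

fun lex_arc :: "('a \<times> 'a) set \<Rightarrow> 'a list \<Rightarrow> 'a list \<Rightarrow> bool" where
  "lex_arc R (x # xs) (y # ys) \<longleftrightarrow> (x, y) \<in> R \<or> x = y \<and> lex_arc R xs ys"
| "lex_arc R _ _ \<longleftrightarrow> False"

lemma lex_arc_asym:
  assumes "\<And>x y. (x, y) \<in> R \<Longrightarrow> (y, x) \<notin> R" and "lex_arc R u v"
  shows "\<not> lex_arc R v u"
  using assms(2)
proof (induction u arbitrary: v)
  case (Cons x xs)
  then show ?case using assms(1) by (cases v) auto
qed simp

lemma lex_arc_total:
  assumes "\<And>x y. \<lbrakk>x \<in> A; y \<in> A; x \<noteq> y\<rbrakk> \<Longrightarrow> (x, y) \<in> R \<or> (y, x) \<in> R"
    and "length u = length v" "set u \<subseteq> A" "set v \<subseteq> A" "u \<noteq> v"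
  shows "lex_arc R u v \<or> lex_arc R v u"
  using assms(2-)
proof (induction u v rule: list_induct2)
  case (Cons x xs y ys)
  then show ?case using assms(1)[of x y] by auto
qed simp

text \<open>\<open>L\<close> orients \<open>V\<close> as a tournament. The Ramsey number refers to
  tournaments on naturals with exactly \<open>N\<close> vertices, so for \<open>N <= card V\<close>
  a subset of size \<open>N\<close> is renamed by \<open>h\<close>, and a copy found there is
  carried back to \<open>V\<close>.\<close>

lemma oriented_ramsey_number_gt:
  fixes H :: "'b pair_pre_digraph" and V :: "'a set"
  assumes H: "acyclic_digraph H" and finV: "finite V"
    and total: "\<And>x y. \<lbrakk>x \<in> V; y \<in> V; x \<noteq> y\<rbrakk> \<Longrightarrow> L x y \<or> L y x"
    and asym: "\<And>x y. \<lbrakk>x \<in> V; y \<in> V; L x y\<rbrakk> \<Longrightarrow> \<not> L y x"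
    and no_copy: "\<And>f. \<lbrakk>inj_on f (pverts H); f ` pverts H \<subseteq> V\<rbrakk> \<Longrightarrow> \<exists>(u, v)\<in>parcs H. \<not> L (f u) (f v)"
  shows "card V < oriented_ramsey_number H"
proof (rule ccontr)
  interpret H: acyclic_digraph H by (rule H)
  define N where "N = oriented_ramsey_number H"
  assume "\<not> ?thesis"
  then have "N \<le> card V" by (simp add: N_def)
  then obtain V' where V': "V' \<subseteq> V" "card V' = N" by (meson obtain_subset_with_card_n)
  then obtain h where h: "bij_betw h {..<N} V'"
    using finite_same_card_bij[of "{..<N}" V'] finV finite_subset by auto
  then have hV: "h i \<in> V" if "i < N" for i using that V'(1) bij_betwE by blast
  have h_inj: "h i \<noteq> h j" if "i < N" "j < N" "i \<noteq> j" for i j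
    using that h by (auto simp: bij_betw_def inj_on_def)
  define T :: "nat pair_pre_digraph" where
    "T = \<lparr>pverts = {..<N}, parcs = {(i, j). i < N \<and> j < N \<and> L (h i) (h j)}\<rparr>"
  have "tournament T"
  proof unfold_locales
    have "parcs T \<subseteq> {..<N} \<times> {..<N}" by (auto simp: T_def)
    then show "finite (parcs T)" by (rule finite_subset) simp
    show "fst e \<noteq> snd e" if "e \<in> parcs T" for e
      using that asym[of "h (fst e)" "h (fst e)"] hV by (auto simp: T_def)
    show "(v, u) \<notin> parcs T" if "(u, v) \<in> parcs T" for u v
      using that asym[of "h u" "h v"] hV by (auto simp: T_def)
    show "(u, v) \<in> parcs T \<or> (v, u) \<in> parcs T"
      if "u \<in> pverts T" "v \<in> pverts T" "u \<noteq> v" for u v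
      using that total[of "h u" "h v"] hV h_inj by (auto simp: T_def)
  qed (auto simp: T_def)
  moreover have "card (pverts T) = N" by (simp add: T_def)
  ultimately have "contains_copy T H"
    using LeastI_ex[OF oriented_ramsey_number_exists[OF H]]
    unfolding N_def oriented_ramsey_number_def by blast
  then obtain f where f: "inj_on f (pverts H)" "f ` pverts H \<subseteq> {..<N}"
    "\<And>u v. (u, v) \<in> parcs H \<Longrightarrow> (f u, f v) \<in> parcs T"
    unfolding contains_copy_def by (fastforce simp: T_def)
  have "inj_on h {..<N}" using h by (simp add: bij_betw_def)
  then have "inj_on (h \<circ> f) (pverts H)"
    using f(1,2) comp_inj_on inj_on_subset by blast
  moreover have "(h \<circ> f) ` pverts H \<subseteq> V" using f(2) hV by auto
  ultimately have "\<exists>(u, v)\<in>parcs H. \<not> L ((h \<circ> f) u) ((h \<circ> f) v)" by (rule no_copy)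
  then obtain u v where "(u, v) \<in> parcs H" "\<not> L (h (f u)) (h (f v))" by auto
  then show False using f(3) by (auto simp: T_def)
qed

text \<open>The usual order on one vertex fewer than \<open>H\<close> has is a tournament with no
  room for an injection.\<close>

lemma card_verts_le_oriented_ramsey_number:
  assumes "acyclic_digraph H"
  shows "card (pverts H) \<le> oriented_ramsey_number H"
proof (cases "card (pverts H) = 0")
  case False
  have "card {..<card (pverts H) - 1} < oriented_ramsey_number H"
  proof (rule oriented_ramsey_number_gt[OF assms, where L = "(<)"])
    fix f :: "'a \<Rightarrow> nat" assume "inj_on f (pverts H)" "f ` pverts H \<subseteq> {..<card (pverts H) - 1}"
    then show "\<exists>(u, v)\<in>parcs H. \<not> f u < f v"
      using card_inj_on_le[of f "pverts H" "{..<card (pverts H) - 1}"] False by simp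
  qed auto
  then show ?thesis by simp
qed simp

section \<open>Digraphs on initial segments of the naturals\<close>

definition initial_digraph :: "(nat \<times> nat) set \<Rightarrow> nat \<Rightarrow> nat pair_pre_digraph" where
  "initial_digraph E n = \<lparr>pverts = {..<n}, parcs = E \<inter> {..<n} \<times> {..<n}\<rparr>"

lemma acyclic_initial_digraph:
  assumes "\<And>x y. (x, y) \<in> E \<Longrightarrow> x < y"
  shows "acyclic_digraph (initial_digraph E n)"
proof -
  let ?H = "initial_digraph E n"
  have less: "u < v" if "(u, v) \<in> parcs ?H" for u v
    using that assms by (simp add: initial_digraph_def)
  interpret oriented_digraph ?H
  proof unfold_locales
    have "parcs ?H \<subseteq> {..<n} \<times> {..<n}" by (auto simp: initial_digraph_def)
    then show "finite (parcs ?H)" by (rule finite_subset) simp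
    show "fst e \<noteq> snd e" if "e \<in> parcs ?H" for e
      using that less[of "fst e" "snd e"] by simp
    show "(v, u) \<notin> parcs ?H" if "(u, v) \<in> parcs ?H" for u v
      using less[OF that] less[of v u] by auto
  qed (auto simp: initial_digraph_def)
  show ?thesis
  proof (unfold_locales, rule notI)
    fix p assume "cycle p"
    then obtain u where "awalk u p u" "p \<noteq> []" by (auto simp: cycle_def)
    then have "(u, u) \<in> (parcs ?H)\<^sup>+" using reachable1_awalk by blast
    moreover have "wf (parcs ?H)"
      by (rule wf_subset[OF wf_less_than]) (auto dest: less)
    ultimately show False using wf_acyclic by (auto simp: acyclic_def)
  qed
qed

section \<open>The Ramsey number of the mesh\<close>

text \<open>First coordinates colour the interval. On a monochromatic run shorter by at most the
  factor \<open>m\<close>, deleting them leaves an embedding with one coordinate fewer; with no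
  coordinates left there is room for one vertex only.\<close>

lemma (in interval_mesh) lex_embedding_bound:
  assumes asym: "\<And>c d. (c, d) \<in> R \<Longrightarrow> (d, c) \<notin> R"
    and no_chain: "\<And>f :: nat \<Rightarrow> 'c. \<exists>i j. i < j \<and> j < t \<and> (f i, f j) \<notin> R"
    and "inj_on f {lo..<hi}" "\<And>i. i \<in> {lo..<hi} \<Longrightarrow> length (f i) = k"
    and "\<And>x y. \<lbrakk>(x, y) \<in> E; x \<in> {lo..<hi}; y \<in> {lo..<hi}\<rbrakk> \<Longrightarrow> lex_arc R (f x) (f y)"
  shows "hi - lo \<le> m * b * m ^ k"
  using assms(3-)
proof (induction k arbitrary: f lo hi)
  case 0
  have "f ` {lo..<hi} \<subseteq> {[]}" using 0(2) by auto
  then have "card {lo..<hi} \<le> card {[] :: 'c list}"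
    using 0(1) by (intro card_inj_on_le[of f]) auto
  then show ?case using mb_gt_1 by simp
next
  case (Suc k)
  show ?case
  proof (rule ccontr)
    assume "\<not> ?thesis"
    then have large: "m * b * m ^ Suc k < hi - lo" by simp
    have "m * b * 1 \<le> m * b * m ^ Suc k" using m_pos by (intro mult_le_mono2) simp
    then have mb: "m * b \<le> hi - lo" using large by linarith
    have cons: "f i = hd (f i) # tl (f i)" if "i \<in> {lo..<hi}" for i
      using Suc.prems(2)[OF that] by (cases "f i") auto
    have arc: "(hd (f x), hd (f y)) \<in> R \<or> hd (f x) = hd (f y) \<and> lex_arc R (tl (f x)) (tl (f y))"
      if "(x, y) \<in> E" "x \<in> {lo..<hi}" "y \<in> {lo..<hi}" for x y
      using Suc.prems(3)[OF that] cons[OF that(2)] cons[OF that(3)] by (metis lex_arc.simps(1))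
    have "hom_on R (\<lambda>i. hd (f i)) lo hi"
      unfolding hom_on_def using arc by fastforce
    then obtain a y where ay: "lo \<le> a" "a + y \<le> hi" "mono_run (\<lambda>i. hd (f i)) a y" "hi - lo \<le> m * y"
      using long_run[OF asym no_chain _ mb] by blast
    have sub: "i \<in> {lo..<hi}" if "i \<in> {a..<a + y}" for i using that ay by simp
    have hd: "hd (f i) = hd (f a)" if "i \<in> {a..<a + y}" for i
      using mono_runD[OF ay(3), of i] that by simp
    have "a + y - a \<le> m * b * m ^ k"
    proof (rule Suc.IH[of "\<lambda>i. tl (f i)"])
      show "inj_on (\<lambda>i. tl (f i)) {a..<a + y}"
      proof (rule inj_onI)
        fix i j assume ij: "i \<in> {a..<a + y}" "j \<in> {a..<a + y}" "tl (f i) = tl (f j)"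
        then have "f i = f j" using cons[OF sub[OF ij(1)]] cons[OF sub[OF ij(2)]] hd[OF ij(1)] hd[OF ij(2)] by metis
        then show "i = j" using inj_onD[OF Suc.prems(1)] sub ij by blast
      qed
      show "length (tl (f i)) = k" if "i \<in> {a..<a + y}" for i
        using Suc.prems(2)[OF sub[OF that]] by simp
      \<comment> \<open>Asymmetry excludes loops in \<open>R\<close>, so equal heads force the arc
        to come from the tails.\<close>
      show "lex_arc R (tl (f x)) (tl (f z))"
        if "(x, z) \<in> E" "x \<in> {a..<a + y}" "z \<in> {a..<a + y}" for x z
        using arc[OF that(1) sub[OF that(2)] sub[OF that(3)]] hd[OF that(2)] hd[OF that(3)] asym by metis
    qed
    then have "m * y \<le> m * (m * b * m ^ k)" by (intro mult_le_mono2) simp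
    also have "\<dots> = m * b * m ^ Suc k" by simp
    finally show False using large ay(4) by linarith
  qed
qed

text \<open>Here \<open>t = \<beta>\<^sup>2\<close>, \<open>m = 4 * t\<close>, \<open>b = 2 * \<beta>\<close>, \<open>K = 16 * t\<^sup>2\<close>, with \<open>w = m * b\<close> and \<open>L = 4 * K + 4\<close>.\<close>
abbreviation power_mesh :: "nat \<Rightarrow> nat \<Rightarrow> nat pair_pre_digraph" where
  "power_mesh \<beta> \<equiv> initial_digraph (mesh_arcs \<beta> (8 * \<beta> ^ 3) (64 * \<beta> ^ 4 + 4))"

text \<open>Near arcs cost \<open>8 * \<beta> ^ 3\<close> on each side. Far arcs cost order
  \<open>L / \<beta>\<close>, which is again of order \<open>\<beta> ^ 3\<close> because
  \<open>L\<close> has order \<open>\<beta> ^ 4\<close>.\<close>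

lemma max_degree_power_mesh:
  assumes "2 \<le> \<beta>" "0 < n"
  shows "max_degree (power_mesh \<beta> n) \<le> 1000 * \<beta> ^ 3"
proof -
  define L where "L = 64 * \<beta> ^ 4 + 4"
  define w where "w = 8 * \<beta> ^ 3"
  let ?E = "mesh_arcs \<beta> w L"
  have \<beta>: "0 < \<beta>" using assms by simp
  have "\<beta> ^ 1 \<le> \<beta> ^ 4" using \<beta> by (intro power_increasing) auto
  then have L: "\<beta> \<le> L" by (simp add: L_def)
  have "2 ^ 3 \<le> \<beta> ^ 3" using assms by (intro power_mono) auto
  then have cube: "8 \<le> \<beta> ^ 3" by simp
  have far: "card (far_arcs_at \<beta> L x) \<le> 400 * \<beta> ^ 3" for x
  proof -
    have "card (far_arcs_at \<beta> L x) * \<beta> \<le> 6 * L + 3 * \<beta>" by (rule far_arcs_at_bound(2)[OF \<beta> L])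
    \<comment> \<open>The coefficient is \<open>6 * 64\<close>; the rest,
      \<open>24 + 3 * \<beta>\<close>, is at most \<open>15 * \<beta>\<close> from
      \<open>\<beta> = 2\<close> on.\<close>
    also have "\<dots> \<le> (384 * \<beta> ^ 3 + 15) * \<beta>"
      using assms(1) by (simp add: L_def power4_eq_xxxx power3_eq_cube algebra_simps)
    also have "\<dots> \<le> (400 * \<beta> ^ 3) * \<beta>"
      using cube by (intro mult_le_mono1) linarith
    finally show ?thesis using \<beta> by simp
  qed
  have "card (out_nbhd (initial_digraph ?E n) v) + card (in_nbhd (initial_digraph ?E n) v) \<le> 1000 * \<beta> ^ 3" for v
  proof -
    have "card (out_nbhd (initial_digraph ?E n) v) \<le> card {y. (v, y) \<in> ?E}"
      by (rule card_mono[OF mesh_arcs_out_degree(1)[OF \<beta> L]])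
        (auto simp: out_nbhd_def initial_digraph_def)
    moreover have "card (in_nbhd (initial_digraph ?E n) v) \<le> card {y. (y, v) \<in> ?E}"
      by (rule card_mono[OF mesh_arcs_in_degree(1)[OF \<beta> L]])
        (auto simp: in_nbhd_def initial_digraph_def)
    ultimately show ?thesis
      using mesh_arcs_out_degree(2)[OF \<beta> L, of v w] mesh_arcs_in_degree(2)[OF \<beta> L, of v w] far[of v]
      unfolding w_def by linarith
  qed
  then show ?thesis
    using assms(2) unfolding max_degree_def L_def w_def
    by (subst Max_le_iff) (auto simp: initial_digraph_def)
qed

lemma acyclic_power_mesh: "0 < \<beta> \<Longrightarrow> acyclic_digraph (power_mesh \<beta> n)"
  by (rule acyclic_initial_digraph) (rule mesh_arcs_less)

text \<open>The host is the \<open>k\<close>-th lexicographic power of a tournament on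
  \<open>s\<close> vertices; \<open>n\<close> is just above the bound \<open>m * b * m ^ k\<close>
  for meshes embedded in it.\<close>

lemma oriented_ramsey_number_power_mesh:
  assumes "2 \<le> \<beta>" and n: "8 * \<beta> ^ 3 * (4 * \<beta>\<^sup>2) ^ k < n"
  shows "(2 ^ ((\<beta>\<^sup>2 - 2) div 2)) ^ k < oriented_ramsey_number (power_mesh \<beta> n)"
proof -
  define t where "t = \<beta>\<^sup>2"
  define m where "m = 4 * t"
  define K where "K = 4 * t * m"
  \<comment> \<open>With this exponent \<open>s ^ t\<close> is at most \<open>2\<close> to the power
    \<open>t * (t - 2) / 2\<close>, which the counting argument needs below
    \<open>t * (t - 1) / 2\<close>.\<close>
  define s :: nat where "s = 2 ^ ((t - 2) div 2)"
  define E where "E = mesh_arcs \<beta> (8 * \<beta> ^ 3) (64 * \<beta> ^ 4 + 4)"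
  have \<beta>: "0 < \<beta>" using assms by simp
  have "2\<^sup>2 \<le> t" unfolding t_def using assms by (intro power_mono) auto
  then have t: "4 \<le> t" by simp
  have w: "8 * \<beta> ^ 3 = m * (2 * \<beta>)" by (simp add: m_def t_def power2_eq_square power3_eq_cube)
  have L: "64 * \<beta> ^ 4 + 4 = 4 * K + 4"
    by (simp add: K_def m_def t_def power2_eq_square power4_eq_xxxx)
  \<comment> \<open>The value \<open>2 * \<beta>\<close> for \<open>b\<close> is a length that
    ensures an aligned block of level 0.\<close>
  interpret interval_mesh E K m "2 * \<beta>" t
  proof
    show "(x, y) \<in> E" if "x < y" "y < x + m * (2 * \<beta>)" for x y
      using that unfolding E_def w mesh_arcs_def by blast
    show "\<exists>i\<in>{a..<a + x}. \<exists>j\<in>{a'..<a' + x}. (i, j) \<in> E"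
      if "2 * \<beta> \<le> x" "a + x \<le> a'" "a' \<le> a + x + K * x" for x a a'
      unfolding E_def L by (rule mesh_arc_between[OF \<beta> that order_refl])
  qed (use \<beta> t in \<open>simp_all add: m_def K_def\<close>)
  have "s ^ t < 2 ^ (t * (t - 1) div 2)"
  proof -
    have "(t - 2) div 2 * t * 2 \<le> (t - 2) * t"
      using mult_le_mono1[OF div_times_less_eq_dividend[of "t - 2" 2], of t] by (simp add: algebra_simps)
    also have "\<dots> + t \<le> t * (t - 1)" using t by (simp add: algebra_simps diff_mult_distrib)
    finally have "(t - 2) div 2 * t < t * (t - 1) div 2" using t by linarith
    then show ?thesis by (simp add: s_def flip: power_mult)
  qed
  then obtain R :: "(nat \<times> nat) set" where asym: "\<And>x y. (x, y) \<in> R \<Longrightarrow> (y, x) \<notin> R"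
    and total: "\<And>x y. \<lbrakk>x < s; y < s; x \<noteq> y\<rbrakk> \<Longrightarrow> (x, y) \<in> R \<or> (y, x) \<in> R"
    and no_chain: "\<And>f. \<exists>i j. i < j \<and> j < t \<and> (f i, f j) \<notin> R"
    using tournament_without_chain_exists[of s t] t by (metis (no_types, lifting) less_le_trans one_less_numeral_iff semiring_norm(76))
  define V where "V = {u. set u \<subseteq> {..<s} \<and> length u = k}"
  have "card V < oriented_ramsey_number (initial_digraph E n)"
  proof (rule oriented_ramsey_number_gt[where L = "lex_arc R"])
    show "acyclic_digraph (initial_digraph E n)" unfolding E_def by (rule acyclic_power_mesh[OF \<beta>])
    show "finite V" unfolding V_def by (rule finite_lists_length_eq) simp
    show "lex_arc R u v \<or> lex_arc R v u" if "u \<in> V" "v \<in> V" "u \<noteq> v" for u v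
      using that by (intro lex_arc_total[of "{..<s}"] total) (auto simp: V_def)
    show "\<not> lex_arc R v u" if "lex_arc R u v" for u v using lex_arc_asym[OF asym that] .
    fix f assume f: "inj_on f (pverts (initial_digraph E n))" "f ` pverts (initial_digraph E n) \<subseteq> V"
    show "\<exists>(u, v)\<in>parcs (initial_digraph E n). \<not> lex_arc R (f u) (f v)"
    proof (rule ccontr)
      assume "\<not> ?thesis"
      then have arcs: "lex_arc R (f x) (f y)" if "(x, y) \<in> E" "x < n" "y < n" for x y
        using that by (auto simp: initial_digraph_def)
      have "n - 0 \<le> m * (2 * \<beta>) * m ^ k"
      proof (rule lex_embedding_bound[OF asym no_chain, of f])
        show "inj_on f {0..<n}" using f(1) by (simp add: initial_digraph_def lessThan_atLeast0)
        show "length (f i) = k" if "i \<in> {0..<n}" for i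
          using that f(2) by (auto simp: initial_digraph_def V_def)
      qed (use arcs in auto)
      then show False using n unfolding w by (simp add: m_def t_def)
    qed
  qed
  then show ?thesis by (simp add: V_def E_def s_def t_def card_lists_length_eq)
qed

text \<open>For the greatest \<open>k\<close> with \<open>w * m ^ k < n\<close>, the number
  \<open>n\<close> is at most \<open>w * m * m ^ k\<close>. As \<open>w * m\<close> is at most the
  square root of \<open>n\<close>, it follows that \<open>n <= m ^ (2 * k)\<close>; this is the
  source of the factor 2 in the denominator.\<close>

lemma oriented_ramsey_number_power_mesh_powr:
  assumes \<beta>: "2 \<le> \<beta>" and n: "(32 * \<beta> ^ 5)\<^sup>2 \<le> n"
    and \<epsilon>: "\<epsilon> \<le> real ((\<beta>\<^sup>2 - 2) div 2) / (2 * log 2 (4 * (real \<beta>)\<^sup>2))"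
  shows "real n powr \<epsilon> \<le> real (oriented_ramsey_number (power_mesh \<beta> n))"
proof -
  define q where "q = (\<beta>\<^sup>2 - 2) div 2"
  define m where "m = 4 * \<beta>\<^sup>2"
  define w where "w = 8 * \<beta> ^ 3"
  have wm: "w * m = 32 * \<beta> ^ 5" by (simp add: w_def m_def flip: power_add)
  have m: "4 \<le> m" and w: "1 \<le> w" using \<beta> by (simp_all add: m_def w_def)
  have k0: "w * m ^ 0 < n"
  proof -
    have "w * 1 < w * m" using m w by (intro mult_strict_left_mono) auto
    also have "\<dots> \<le> (w * m)\<^sup>2" using m w by (simp add: power2_eq_square)
    finally show ?thesis using n wm by simp
  qed
  have bd: "k \<le> n" if "w * m ^ k < n" for k
  proof -
    have "k \<le> 2 ^ k" using less_exp[of k] by simp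
    also have "\<dots> \<le> m ^ k" using m by (intro power_mono) auto
    also have "\<dots> \<le> w * m ^ k" using w by simp
    finally show ?thesis using that by simp
  qed
  define k where "k = (GREATEST k. w * m ^ k < n)"
  have k: "w * m ^ k < n"
    unfolding k_def by (rule GreatestI_nat[of "\<lambda>k. w * m ^ k < n", OF k0 bd])
  have "\<not> w * m ^ Suc k < n"
    using Greatest_le_nat[of "\<lambda>k. w * m ^ k < n" "Suc k" n] bd unfolding k_def[symmetric] by fastforce
  then have k': "n \<le> (w * m) * m ^ k" by simp
  have n_pos: "0 < n" using k by simp
  have "n\<^sup>2 \<le> ((w * m) * m ^ k)\<^sup>2" using k' by (rule power_mono) simp
  also have "\<dots> = (w * m)\<^sup>2 * (m ^ k)\<^sup>2" by (rule power_mult_distrib)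
  also have "\<dots> \<le> n * (m ^ k)\<^sup>2" using n wm by (intro mult_le_mono1) simp
  finally have "n \<le> (m ^ k)\<^sup>2" using n_pos by (simp add: power2_eq_square)
  then have "real n \<le> real ((m ^ k)\<^sup>2)" by (rule of_nat_mono)
  then have "log 2 (real n) \<le> log 2 (real m ^ (k * 2))"
    using n_pos m by (subst log_le_cancel_iff) (simp_all add: power_mult)
  also have "\<dots> = 2 * real k * log 2 (real m)" using m by (simp add: log_nat_power)
  finally have logn: "log 2 (real n) \<le> 2 * real k * log 2 (real m)" .
  have logm: "0 < log 2 (real m)" using m by simp
  have "\<epsilon> * log 2 (real n) \<le> real q / (2 * log 2 (real m)) * log 2 (real n)"
    using \<epsilon> n_pos by (intro mult_right_mono) (simp_all add: q_def m_def)
  also have "\<dots> \<le> real q / (2 * log 2 (real m)) * (2 * real k * log 2 (real m))"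
    using logn logm by (intro mult_left_mono) simp_all
  also have "\<dots> = real (q * k)" using logm by (simp add: field_simps)
  finally have "2 powr (\<epsilon> * log 2 (real n)) \<le> 2 powr real (q * k)" by (intro powr_mono) simp_all
  also have "\<dots> = real ((2 ^ q) ^ k)" by (simp add: powr_realpow del: of_nat_mult flip: power_mult)
  also have "\<dots> \<le> real (oriented_ramsey_number (power_mesh \<beta> n))"
    using oriented_ramsey_number_power_mesh[OF \<beta>, of k n] k unfolding q_def w_def m_def
    by (intro of_nat_mono) simp
  finally show ?thesis using n_pos by (simp add: powr_def log_def mult.commute)
qed

section \<open>Numerical estimates of the exponent\<close>

lemma cube_powr_two_thirds:
  fixes x :: real
  assumes "0 < x"
  shows "(x ^ 3) powr (2/3) = x\<^sup>2"
proof -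
  have "(x ^ 3) powr (2/3) = (x powr 3) powr (2/3)" using assms by simp
  also have "\<dots> = x powr 2" by (simp only: powr_powr) simp
  finally show ?thesis using assms by simp
qed

text \<open>\<Delta> is at most \<open>(20 * \<beta>) ^ 3\<close>, so the numerator is at most
  \<open>400 * \<beta>\<^sup>2\<close>. The constant balances \<open>400 / 6400\<close> against the
  quotient of \<open>1 / 4\<close> and \<open>2 * 2\<close>.\<close>

lemma exponent_bound:
  assumes \<beta>: "2 \<le> \<beta>" and \<Delta>: "1000 * \<beta> ^ 3 \<le> \<Delta>" "\<Delta> < 1000 * (\<beta> + 1) ^ 3"
  shows "1 / 6400 * real \<Delta> powr (2/3) / log 2 (real \<Delta>) powr (5/3)
    \<le> real ((\<beta>\<^sup>2 - 2) div 2) / (2 * log 2 (4 * (real \<beta>)\<^sup>2))"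
proof -
  define l where "l = log 2 (real \<Delta>)"
  have "\<beta> ^ 1 \<le> \<beta> ^ 3" using \<beta> by (intro power_increasing) auto
  then have "2 * \<beta> \<le> \<Delta>" using \<Delta>(1) by simp
  then have "2 * real \<beta> \<le> real \<Delta>" by linarith
  then have "log 2 (2 * real \<beta>) \<le> l" unfolding l_def using \<beta> by (subst log_le_cancel_iff) auto
  then have l\<beta>: "1 + log 2 (real \<beta>) \<le> l" using \<beta> by (simp add: log_mult)
  have "0 \<le> log 2 (real \<beta>)" using \<beta> by simp
  then have l: "1 \<le> l" using l\<beta> by linarith
  have "log 2 (4 * (real \<beta>)\<^sup>2) = 2 * (1 + log 2 (real \<beta>))"
  proof -
    have "4 * (real \<beta>)\<^sup>2 = (2 * real \<beta>) ^ 2" by (simp add: power_mult_distrib)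
    then have "log 2 (4 * (real \<beta>)\<^sup>2) = 2 * log 2 (2 * real \<beta>)"
      using log_nat_power[of "2 * real \<beta>" 2 2] \<beta> by simp
    then show ?thesis using \<beta> by (simp add: log_mult)
  qed
  then have logm: "log 2 (4 * (real \<beta>)\<^sup>2) \<le> 2 * l" "0 < log 2 (4 * (real \<beta>)\<^sup>2)"
    using l\<beta> \<open>0 \<le> log 2 (real \<beta>)\<close> by simp_all
  have q: "(real \<beta>)\<^sup>2 / 4 \<le> real ((\<beta>\<^sup>2 - 2) div 2)"
  \<comment> \<open>At \<open>\<beta> = 2\<close> both sides equal 1; for larger values
    \<open>9 <= \<beta>\<^sup>2\<close> absorbs the rounding.\<close>
  proof (cases "\<beta> = 2")
    case False
    then have "3 ^ 2 \<le> \<beta>\<^sup>2" using \<beta> by (intro power_mono) auto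
    then have "\<beta>\<^sup>2 \<le> 4 * ((\<beta>\<^sup>2 - 2) div 2)" by simp
    then have "real (\<beta>\<^sup>2) \<le> real (4 * ((\<beta>\<^sup>2 - 2) div 2))" by (rule of_nat_mono)
    then show ?thesis by simp
  qed simp
  have "\<Delta> \<le> (20 * \<beta>) ^ 3"
  proof -
    have "(\<beta> + 1) ^ 3 \<le> (2 * \<beta>) ^ 3" using \<beta> by (intro power_mono) auto
    then show ?thesis using \<Delta>(2) by (simp add: power_mult_distrib)
  qed
  then have "real \<Delta> \<le> real ((20 * \<beta>) ^ 3)" by (rule of_nat_mono)
  then have "real \<Delta> powr (2/3) \<le> ((20 * real \<beta>) ^ 3) powr (2/3)" by (intro powr_mono2) simp_all
  also have "\<dots> = (20 * real \<beta>)\<^sup>2" using \<beta> by (intro cube_powr_two_thirds) simp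
  also have "\<dots> = 400 * (real \<beta>)\<^sup>2" by (simp add: power_mult_distrib)
  finally have num: "real \<Delta> powr (2/3) \<le> 400 * (real \<beta>)\<^sup>2" .
  have "l powr 1 \<le> l powr (5/3)" using l by (intro powr_mono) simp_all
  then have den: "l \<le> l powr (5/3)" using l by simp
  have "1 / 6400 * real \<Delta> powr (2/3) / l powr (5/3) \<le> 1 / 6400 * (400 * (real \<beta>)\<^sup>2) / l"
    using num den l by (intro frac_le mult_left_mono) simp_all
  also have "\<dots> = ((real \<beta>)\<^sup>2 / 4) / (2 * (2 * l))" by simp
  also have "\<dots> \<le> real ((\<beta>\<^sup>2 - 2) div 2) / (2 * log 2 (4 * (real \<beta>)\<^sup>2))"
    using q logm l by (intro frac_le) simp_all
  finally show ?thesis by (simp add: l_def)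
qed

lemma small_exponent_bound:
  assumes "2 \<le> \<Delta>" "\<Delta> < 8000"
  shows "1 / 6400 * real \<Delta> powr (2/3) / log 2 (real \<Delta>) powr (5/3) \<le> 1"
proof -
  have "real \<Delta> powr (2/3) \<le> (20 ^ 3) powr (2/3)" using assms by (intro powr_mono2) simp_all
  also have "(20 ^ 3) powr (2/3) = (20::real)\<^sup>2" by (rule cube_powr_two_thirds) simp
  finally have num: "1 / 6400 * real \<Delta> powr (2/3) \<le> 1" by simp
  have "log 2 2 \<le> log 2 (real \<Delta>)" using assms by (subst log_le_cancel_iff) auto
  then have "1 \<le> log 2 (real \<Delta>)" by simp
  then have "1 \<le> log 2 (real \<Delta>) powr (5/3)" by (rule ge_one_powr_ge_zero) simp
  then show ?thesis using num by (simp add: divide_le_eq)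
qed

theorem theorem1p2:
  shows "\<exists>c::real. c > 0 \<and>
    (\<forall>\<Delta>::nat. \<Delta> \<ge> 2 \<longrightarrow>
      (\<forall>\<^sub>F n::nat in sequentially.
        \<exists>H :: nat pair_pre_digraph.
          acyclic_digraph H \<and> card (pverts H) = n \<and> max_degree H \<le> \<Delta> \<and>
          real (oriented_ramsey_number H)
            \<ge> real n powr (c * real \<Delta> powr (2/3) / (log 2 (real \<Delta>)) powr (5/3))))"
proof (intro exI[of _ "1 / 6400"] conjI allI impI)
  fix \<Delta> :: nat assume \<Delta>: "2 \<le> \<Delta>"
  let ?\<epsilon> = "1 / 6400 * real \<Delta> powr (2/3) / log 2 (real \<Delta>) powr (5/3)"
  let ?good = "\<lambda>n (H :: nat pair_pre_digraph). acyclic_digraph H \<and> card (pverts H) = n \<and> max_degree H \<le> \<Delta> \<and>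
    real n powr ?\<epsilon> \<le> real (oriented_ramsey_number H)"
  show "\<forall>\<^sub>F n in sequentially. \<exists>H :: nat pair_pre_digraph. ?good n H"
  proof (cases "\<Delta> < 8000")
    case True
    show ?thesis
    proof (rule eventually_sequentiallyI[of 1])
      fix n :: nat assume n: "1 \<le> n"
      \<comment> \<open>The exponent is at most 1, so a digraph without arcs suffices.\<close>
      let ?H = "initial_digraph {} n"
      have acyc: "acyclic_digraph ?H" by (rule acyclic_initial_digraph) simp
      have card: "card (pverts ?H) = n" by (simp add: initial_digraph_def)
      have "max_degree ?H \<le> \<Delta>"
        unfolding max_degree_def
        using n by (subst Max_le_iff) (auto simp: lessThan_empty_iff out_nbhd_def in_nbhd_def initial_digraph_def)
      moreover have "real n powr ?\<epsilon> \<le> real n powr 1"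
        using n small_exponent_bound[OF \<Delta> True] by (intro powr_mono) simp_all
      then have "real n powr ?\<epsilon> \<le> real (oriented_ramsey_number ?H)"
        using card_verts_le_oriented_ramsey_number[OF acyc] card n by simp
      ultimately show "\<exists>H. ?good n H" using acyc card by blast
    qed
  next
    case False
    \<comment> \<open>The largest parameter whose mesh respects the degree bound, of order \<Delta>
      to the power \<open>1 / 3\<close>.\<close>
    define \<beta> where "\<beta> = (GREATEST b. 1000 * b ^ 3 \<le> \<Delta>)"
    have bd: "b \<le> \<Delta>" if "1000 * b ^ 3 \<le> \<Delta>" for b
    proof -
      have "b \<le> b ^ 3" by (cases "b = 0") (simp_all add: self_le_power)
      then show ?thesis using that by simp
    qed
    have two: "1000 * 2 ^ 3 \<le> \<Delta>" using False by simp
    have \<beta>1: "1000 * \<beta> ^ 3 \<le> \<Delta>"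
      unfolding \<beta>_def by (rule GreatestI_nat[of "\<lambda>b. 1000 * b ^ 3 \<le> \<Delta>", OF two bd])
    have \<beta>2: "2 \<le> \<beta>"
      unfolding \<beta>_def by (rule Greatest_le_nat[of "\<lambda>b. 1000 * b ^ 3 \<le> \<Delta>", OF two bd])
    have "\<not> 1000 * (\<beta> + 1) ^ 3 \<le> \<Delta>"
      using Greatest_le_nat[of "\<lambda>b. 1000 * b ^ 3 \<le> \<Delta>" "\<beta> + 1" \<Delta>] bd
      unfolding \<beta>_def[symmetric] by fastforce
    then have \<epsilon>: "?\<epsilon> \<le> real ((\<beta>\<^sup>2 - 2) div 2) / (2 * log 2 (4 * (real \<beta>)\<^sup>2))"
      by (intro exponent_bound[OF \<beta>2 \<beta>1]) simp
    show ?thesis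
    proof (rule eventually_sequentiallyI[of "(32 * \<beta> ^ 5)\<^sup>2"])
      fix n :: nat assume n: "(32 * \<beta> ^ 5)\<^sup>2 \<le> n"
      have "0 < (32 * \<beta> ^ 5)\<^sup>2" using \<beta>2 by simp
      then have "max_degree (power_mesh \<beta> n) \<le> 1000 * \<beta> ^ 3"
        using n by (intro max_degree_power_mesh[OF \<beta>2]) linarith
      then have "max_degree (power_mesh \<beta> n) \<le> \<Delta>" using \<beta>1 by linarith
      moreover have "acyclic_digraph (power_mesh \<beta> n)" using \<beta>2 by (intro acyclic_power_mesh) simp
      moreover have "card (pverts (power_mesh \<beta> n)) = n" by (simp add: initial_digraph_def)
      ultimately show "\<exists>H. ?good n H"
        using oriented_ramsey_number_power_mesh_powr[OF \<beta>2 n \<epsilon>] by blast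
    qed
  qed
qed simp

end
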